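(* Let $n>2$. Every linear Nambu-Poisson tensor $\Lambda$ of order $n$ on $\mathbb R^m$ is, in suitable linear coordinates $x_1,\dots,x_m$ (with $\partial_i=\partial/\partial x_i$), of one of the following forms: (A) $\Lambda=\varphi\,\partial_1\wedge\cdots\wedge\partial_n$, where $\varphi$ is a linear function; or (C) $\Lambda=\partial_1\wedge\cdots\wedge\partial_{n-1}\wedge\Big(\sum_{i,j\ge n}a_{ij}x_i\partial_j\Big)$ for some constants $a_{ij}$; or (B) $\Lambda=i_\alpha(\partial_1\wedge\cdots\wedge\partial_{n+1})$, where the linear 1-form $\alpha$ is as follows: (1) in the case $d(\alpha_{|\mathbb R^{n+1}})=0$, $$\alpha=d\varphi+\sum_{i>n+1,\ j\le n+1}a_{ij}x_i\,dx_j,$$ where $\varphi$ is a quadratic polynomial in the variables $x_1,\dots,x_{n+1}$ and $a_{ij}\in\mathbb R$; (2) in the case $d(\alpha_{|\mathbb R^{n+1}})(0)\neq0$, $$\alpha=d\varphi+\frac12\Big(\big(x_1+\sum_{i>2}a_ix_i\big)dx_2-\big(x_2+\sum_{j>2}b_jx_j\big)dx_1\Big),$$ where $\varphi$ is a quadratic polynomial in the variables $x_1,x_2$ and $a_i,b_j\in\mathbb R$.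
   Context: An $n$-vector field $\Lambda$ on a manifold is a Nambu-Poisson tensor of order $n$ if the bracket $\{f_1,\dots,f_n\}=i_{df_n}\cdots i_{df_1}\Lambda$ satisfies the Filippov identity $$\{f_1,\dots,f_{n-1},\{g_1,\dots,g_n\}\}=\sum_{i=1}^n\{g_1,\dots,\{f_1,\dots,f_{n-1},g_i\},\dots,g_n\}$$ for all smooth functions. A multivector field or a 1-form on $\mathbb R^m$ is linear if its coefficients in linear coordinates are linear functions. $i_\alpha$ denotes contraction with $\alpha$. $\mathbb R^{n+1}$ denotes the subspace of $\mathbb R^m$ with coordinates $x_1,\dots,x_{n+1}$ (where $x_i=0$ for $i>n+1$), and $\alpha_{|\mathbb R^{n+1}}$ is the restriction of the 1-form $\alpha$ to it; in (B), $\alpha$ is of the form $\sum_{j\le n+1}c_{ij}x_i\,dx_j$. *)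

theory Defs
  imports "HOL-Analysis.Analysis"
begin

fun C_k :: "nat \<Rightarrow> ('v::real_normed_vector \<Rightarrow> real) \<Rightarrow> bool" where
  "C_k 0 f \<longleftrightarrow> continuous_on UNIV f"
| "C_k (Suc k) f \<longleftrightarrow>
     (\<forall>p. f differentiable (at p)) \<and> (\<forall>u. C_k k (\<lambda>p. frechet_derivative f (at p) u))"

definition smooth_function :: "('v::real_normed_vector \<Rightarrow> real) \<Rightarrow> bool" where
  "smooth_function f \<longleftrightarrow> (\<forall>k. C_k k f)"

text \<open>Covectors on \<open>V\<close> are elements of \<open>V \<Rightarrow>\<^sub>L real\<close>, and 1-forms are functions
  \<open>V \<Rightarrow> (V \<Rightarrow>\<^sub>L real)\<close>.\<close>

definition differential :: "('v::real_normed_vector \<Rightarrow> real) \<Rightarrow> 'v \<Rightarrow> ('v \<Rightarrow>\<^sub>L real)" where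
  "differential f p = Blinfun (frechet_derivative f (at p))"

text \<open>\<open>ext_deriv \<alpha> p u v\<close> is \<open>d\<alpha>(u, v) = \<partial>\<^sub>u (\<alpha>(v)) - \<partial>\<^sub>v (\<alpha>(u))\<close> at \<open>p\<close>, with \<open>u\<close>, \<open>v\<close> regarded as
  constant vector fields. When \<open>p\<close>, \<open>u\<close>, \<open>v\<close> lie in a linear subspace \<open>W\<close>, it only uses the
  values of \<open>\<alpha>\<close> at points of \<open>W\<close> on vectors of \<open>W\<close>, so it is then the exterior derivative of
  the restriction of \<open>\<alpha>\<close> to \<open>W\<close>.\<close>

definition ext_deriv ::
    "('v::real_normed_vector \<Rightarrow> ('v \<Rightarrow>\<^sub>L real)) \<Rightarrow> 'v \<Rightarrow> 'v \<Rightarrow> 'v \<Rightarrow> real" where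
  "ext_deriv \<alpha> p u v =
     deriv (\<lambda>t. blinfun_apply (\<alpha> (p + t *\<^sub>R u)) v) 0 - deriv (\<lambda>t. blinfun_apply (\<alpha> (p + t *\<^sub>R v)) u) 0"

text \<open>An \<open>n\<close>-vector is an alternating \<open>n\<close>-linear function of \<open>n\<close> covectors, given as a function on
  lists of covectors. It is 0 by convention on lists of any other length, so that equality of
  \<open>n\<close>-vectors is equality of functions.\<close>

definition multivector :: "nat \<Rightarrow> (('v::real_normed_vector \<Rightarrow>\<^sub>L real) list \<Rightarrow> real) \<Rightarrow> bool" where
  "multivector n T \<longleftrightarrow>
     (\<forall>\<xi>s. length \<xi>s \<noteq> n \<longrightarrow> T \<xi>s = 0) \<and>
     (\<forall>\<xi>s i. length \<xi>s = n \<and> i < n \<longrightarrow> linear (\<lambda>\<eta>. T (\<xi>s[i := \<eta>]))) \<and>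
     (\<forall>\<xi>s i j. length \<xi>s = n \<and> i < j \<and> j < n \<and> \<xi>s ! i = \<xi>s ! j \<longrightarrow> T \<xi>s = 0)"

text \<open>Normalization: \<open>(v\<^sub>1 \<and> \<dots> \<and> v\<^sub>n)(\<xi>\<^sub>1, \<dots>, \<xi>\<^sub>n) = det (\<xi>\<^sub>i(v\<^sub>j))\<close>.\<close>

definition wedge :: "'v::real_normed_vector list \<Rightarrow> ('v \<Rightarrow>\<^sub>L real) list \<Rightarrow> real" where
  "wedge vs \<xi>s =
     (if length \<xi>s = length vs
      then \<Sum>\<pi> | \<pi> permutes {..<length vs}.
             of_int (sign \<pi>) * (\<Prod>i<length vs. blinfun_apply (\<xi>s ! i) (vs ! \<pi> i))
      else 0)"

definition contract ::
    "('v::real_normed_vector \<Rightarrow>\<^sub>L real) \<Rightarrow> (('v \<Rightarrow>\<^sub>L real) list \<Rightarrow> real) \<Rightarrow> ('v \<Rightarrow>\<^sub>L real) list \<Rightarrow> real" where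
  "contract \<alpha> T = (\<lambda>\<xi>s. T (\<alpha> # \<xi>s))"

definition multivector_field ::
    "nat \<Rightarrow> ('v::real_normed_vector \<Rightarrow> ('v \<Rightarrow>\<^sub>L real) list \<Rightarrow> real) \<Rightarrow> bool" where
  "multivector_field n \<Lambda> \<longleftrightarrow>
     (\<forall>p. multivector n (\<Lambda> p)) \<and> (\<forall>\<xi>s. smooth_function (\<lambda>p. \<Lambda> p \<xi>s))"

text \<open>The coefficients of \<open>\<Lambda>\<close> in linear coordinates are its values on constant covectors.\<close>

definition linear_multivector_field ::
    "nat \<Rightarrow> ('v::real_normed_vector \<Rightarrow> ('v \<Rightarrow>\<^sub>L real) list \<Rightarrow> real) \<Rightarrow> bool" where
  "linear_multivector_field n \<Lambda> \<longleftrightarrow> multivector_field n \<Lambda> \<and> (\<forall>\<xi>s. linear (\<lambda>p. \<Lambda> p \<xi>s))"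

text \<open>\<open>i\<^bsub>df\<^sub>n\<^esub> \<dots> i\<^bsub>df\<^sub>1\<^esub> \<Lambda>\<close>: contracting successively with \<open>df\<^sub>1, \<dots>, df\<^sub>n\<close> fills the slots from the
  first to the last.\<close>

definition nambu_bracket ::
    "('v::real_normed_vector \<Rightarrow> ('v \<Rightarrow>\<^sub>L real) list \<Rightarrow> real) \<Rightarrow> ('v \<Rightarrow> real) list \<Rightarrow> 'v \<Rightarrow> real" where
  "nambu_bracket \<Lambda> fs = (\<lambda>p. \<Lambda> p (map (\<lambda>f. differential f p) fs))"

definition nambu_poisson ::
    "nat \<Rightarrow> ('v::real_normed_vector \<Rightarrow> ('v \<Rightarrow>\<^sub>L real) list \<Rightarrow> real) \<Rightarrow> bool" where
  "nambu_poisson n \<Lambda> \<longleftrightarrow>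
     multivector_field n \<Lambda> \<and>
     (\<forall>fs gs. Suc (length fs) = n \<and> length gs = n \<and> (\<forall>f \<in> set fs \<union> set gs. smooth_function f) \<longrightarrow>
        (\<forall>p. nambu_bracket \<Lambda> (fs @ [nambu_bracket \<Lambda> gs]) p =
             (\<Sum>i<n. nambu_bracket \<Lambda> (gs[i := nambu_bracket \<Lambda> (fs @ [gs ! i])]) p)))"

text \<open>Linear coordinates \<open>x\<^sub>1, \<dots>, x\<^sub>m\<close> on \<open>\<real>\<^sup>m\<close> together with the dual basis \<open>e\<^sub>1, \<dots>, e\<^sub>m\<close>, so that
  \<open>e\<^sub>i\<close> is the (constant) vector field \<open>\<partial>/\<partial>x\<^sub>i\<close>. Values at indices outside \<open>{1..m}\<close> are arbitrary.\<close>

definition linear_coordinates ::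
    "(nat \<Rightarrow> real ^ 'm \<Rightarrow> real) \<Rightarrow> (nat \<Rightarrow> real ^ 'm) \<Rightarrow> bool" where
  "linear_coordinates x e \<longleftrightarrow>
     (\<forall>i \<in> {1..CARD('m)}. linear (x i)) \<and>
     (\<forall>i \<in> {1..CARD('m)}. \<forall>j \<in> {1..CARD('m)}. x i (e j) = (if i = j then 1 else 0))"

text \<open>Polynomials of degree at most 2 in the variables \<open>x\<^sub>1, \<dots>, x\<^sub>k\<close>.\<close>

definition quadratic_polynomial_in ::
    "(nat \<Rightarrow> 'v \<Rightarrow> real) \<Rightarrow> nat \<Rightarrow> ('v \<Rightarrow> real) \<Rightarrow> bool" where
  "quadratic_polynomial_in x k \<phi> \<longleftrightarrow>
     (\<exists>c l q. \<phi> = (\<lambda>v. c + (\<Sum>i=1..k. l i * x i v) + (\<Sum>i=1..k. \<Sum>j=1..k. q i j * x i v * x j v)))"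

end

theory Submission
  imports Defs
begin

text \<open>
  The differential identity is used through two consequences. Its principal part, obtained by inserting
  squares of linear functions, is a quadratic identity at each point (\<open>square_identity\<close>), which for
  \<open>n > 2\<close> forces the \<open>n\<close>-vector at each point to be decomposable (\<open>kernel_of_nonzero_value\<close>). Its
  restriction to linear functions (\<open>filippov_covectors\<close>) says that these form an \<open>n\<close>-Lie algebra, and
  contains the integrability of the distribution spanned by the tensor.

  So the values of \<open>\<Lambda>\<close> form a linear family of decomposable \<open>n\<close>-vectors. Fix one nonzero member and a
  frame of covectors \<open>a\<^sub>1, \<dots>, a\<^sub>n\<close> on which it takes the value 1, and let \<open>K\<close> be the annihilator of its
  support. Comparison of nearby members shows that every member is determined by its value on the frame and
  by the matrix of its values on the lists \<open>a[i := \<kappa>]\<close> with \<open>\<kappa> \<in> K\<close>, and that this matrix has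
  rank at most one (\<open>kernel_slot\<close>, \<open>kernel_rank_one\<close>). A linear space of matrices of rank at most one
  shares a column or shares a row (\<open>rank_one_family_dichotomy\<close>), which gives three cases.

  If all matrices vanish, the family is one-dimensional, which is (A). If they share a column, the
  supports share a subspace of dimension \<open>n - 1\<close>, so \<open>\<Lambda>\<close> is the wedge of \<open>n - 1\<close> constant vectors with a
  linear vector field, and integrability makes that field independent of the first \<open>n - 1\<close> coordinates,
  which is (C). If they share a row but not a column, the supports lie in a common subspace of dimension
  \<open>n + 1\<close>, so \<open>\<Lambda>\<close> is the contraction of its volume element with a linear 1-form \<open>\<alpha>\<close>. Integrability is
  \<open>\<alpha> \<and> d\<alpha> = 0\<close> on the translates of that subspace; if \<open>d\<alpha>\<close> were nonzero there, all components of
  \<open>\<alpha>\<close> would be combinations of two of them, and the matrices would share a column after all. Thus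
  \<open>\<alpha>\<close> is closed on the subspace and has a quadratic potential, which is (B) in the case (1).
\<close>

section \<open>Alternating multilinear functions\<close>

lemma multivector_length: "multivector n T \<Longrightarrow> length \<xi>s \<noteq> n \<Longrightarrow> T \<xi>s = 0"
  unfolding multivector_def by blast

lemma multivector_linear:
  "multivector n T \<Longrightarrow> length \<xi>s = n \<Longrightarrow> i < n \<Longrightarrow> linear (\<lambda>\<eta>. T (\<xi>s[i := \<eta>]))"
  unfolding multivector_def by blast

lemma multivector_repeat:
  assumes "multivector n T" "i < length \<xi>s" "j < length \<xi>s" "i \<noteq> j" "\<xi>s ! i = \<xi>s ! j"
  shows "T \<xi>s = 0"
  using assms unfolding multivector_def by (cases "length \<xi>s = n"; cases i j rule: linorder_cases) metis+

lemma multivector_not_distinct: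
  assumes "multivector n T" "\<not> distinct \<xi>s"
  shows "T \<xi>s = 0"
  using assms multivector_repeat[OF assms(1)] by (auto simp: distinct_conv_nth)

lemma multivector_diff:
  assumes "multivector n T" "multivector n S"
  shows "multivector n (\<lambda>\<xi>s. T \<xi>s - S \<xi>s)"
  using assms unfolding multivector_def by (auto intro!: linear_compose_sub)

lemma multivector_scale:
  assumes "multivector n T"
  shows "multivector n (\<lambda>\<xi>s. c * T \<xi>s)"
proof -
  have "linear (\<lambda>\<eta>. c * T (\<xi>s[i := \<eta>]))" if "length \<xi>s = n" "i < n" for \<xi>s i
    using linear_compose_scale_right[OF multivector_linear[OF assms that], of c] by simp
  then show ?thesis
    using assms by (simp add: multivector_def)
qed

lemma multivector_contract:
  assumes "multivector (Suc n) T"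
  shows "multivector n (contract \<alpha> T)"
  unfolding multivector_def contract_def
proof (intro conjI allI impI; (elim conjE)?)
  fix \<xi>s :: "('a \<Rightarrow>\<^sub>L real) list" and i
  assume "length \<xi>s = n" "i < n"
  then show "linear (\<lambda>\<eta>. T (\<alpha> # \<xi>s[i := \<eta>]))"
    using multivector_linear[OF assms, of "\<alpha> # \<xi>s" "Suc i"] by simp
next
  fix \<xi>s :: "('a \<Rightarrow>\<^sub>L real) list" and i j
  assume "length \<xi>s = n" "i < j" "j < n" "\<xi>s ! i = \<xi>s ! j"
  then show "T (\<alpha> # \<xi>s) = 0"
    using multivector_repeat[OF assms, of "Suc i" "\<alpha> # \<xi>s" "Suc j"] by simp
qed (use multivector_length[OF assms] in auto)

lemma multivector_update_sum:
  assumes "multivector n T" "length \<xi>s = n" "i < n"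
  shows "T (\<xi>s[i := \<Sum>j\<in>J. c j *\<^sub>R \<eta> j]) = (\<Sum>j\<in>J. c j * T (\<xi>s[i := \<eta> j]))"
  by (simp add: linear_sum[OF multivector_linear[OF assms]] o_def
      linear_cmul[OF multivector_linear[OF assms]])

lemma multivector_swap:
  assumes T: "multivector n T" and len: "length \<xi>s = n" and ij: "i < n" "j < n" "i \<noteq> j"
  shows "T (\<xi>s[i := \<eta>, j := \<theta>]) = - T (\<xi>s[i := \<theta>, j := \<eta>])"
proof -
  have lin_i: "linear (\<lambda>\<rho>. T (\<xi>s[i := \<rho>, j := \<sigma>]))" for \<sigma>
    using multivector_linear[OF T, of "\<xi>s[j := \<sigma>]" i] len ij by (simp add: list_update_swap)
  have lin_j: "linear (\<lambda>\<rho>. T (\<xi>s[i := \<sigma>, j := \<rho>]))" for \<sigma>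
    using multivector_linear[OF T, of "\<xi>s[i := \<sigma>]" j] len ij by simp
  have diag: "T (\<xi>s[i := \<rho>, j := \<rho>]) = 0" for \<rho>
    by (rule multivector_repeat[OF T, of i _ j]) (use len ij in auto)
  have "0 = T (\<xi>s[i := \<eta> + \<theta>, j := \<eta> + \<theta>])"
    by (simp add: diag)
  also have "\<dots> = T (\<xi>s[i := \<eta>, j := \<theta>]) + T (\<xi>s[i := \<theta>, j := \<eta>])"
    unfolding linear_add[OF lin_i] linear_add[OF lin_j] by (simp add: diag)
  finally show ?thesis
    by linarith
qed

lemma multivector_swap_adjacent:
  assumes "multivector n T"
  shows "T (us @ \<eta> # \<theta> # vs) = - T (us @ \<theta> # \<eta> # vs)"
proof (cases "length (us @ \<eta> # \<theta> # vs) = n")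
  case True
  show ?thesis
    using multivector_swap[OF assms True, of "length us" "Suc (length us)" \<eta> \<theta>] True
    by (simp add: list_update_append)
next
  case False
  then show ?thesis
    by (simp add: multivector_length[OF assms])
qed

text \<open>The sign depends only on the number of slots jumped over; identities that are
  linear in \<open>\<eta>\<close> therefore keep one common sign.\<close>

lemma multivector_move:
  assumes "multivector n T"
  shows "T (us @ ws @ \<eta> # vs) = (-1) ^ length ws * T (us @ \<eta> # ws @ vs)"
proof (induction ws arbitrary: us)
  case (Cons \<theta> ws)
  show ?case
    using Cons[of "us @ [\<theta>]"] multivector_swap_adjacent[OF assms, of us \<theta> \<eta> "ws @ vs"] by simp
qed simp

text \<open>Moving one covector past its neighbours only changes the sign, so up to sign the value depends on
  the multiset of arguments alone. Most sign bookkeeping below is avoided by comparing absolute values.\<close>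

lemma multivector_permute:
  assumes "multivector n T" "mset \<xi>s = mset \<eta>s"
  shows "\<bar>T \<xi>s\<bar> = \<bar>T \<eta>s\<bar>"
proof -
  have "\<bar>T (us @ \<xi>s)\<bar> = \<bar>T (us @ \<eta>s)\<bar>" if "mset \<xi>s = mset \<eta>s" for us \<eta>s
    using that
  proof (induction \<xi>s arbitrary: us \<eta>s)
    case (Cons \<xi> \<xi>s)
    then have "\<xi> \<in> set \<eta>s"
      by (metis list.set_intros(1) set_mset_mset)
    then obtain ws vs where \<eta>s: "\<eta>s = ws @ \<xi> # vs"
      by (meson split_list)
    then have "mset \<xi>s = mset (ws @ vs)"
      using Cons.prems by simp
    from Cons.IH[OF this, of "us @ [\<xi>]"] show ?case
      by (simp add: \<eta>s multivector_move[OF assms(1), of us ws] abs_mult)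
  qed simp
  from this[of \<eta>s "[]"] show ?thesis
    using assms(2) by simp
qed

text \<open>The slots may carry different generating sets: the vanishing is transferred from generators to
  spans one slot at a time, from the left.\<close>

lemma multivector_zero_on_span:
  assumes T: "multivector n T"
    and zero: "\<And>\<xi>s. length \<xi>s = n \<Longrightarrow> (\<And>i. i < n \<Longrightarrow> \<xi>s ! i \<in> A i) \<Longrightarrow> T \<xi>s = 0"
    and \<xi>s: "length \<xi>s = n" "\<And>i. i < n \<Longrightarrow> \<xi>s ! i \<in> span (A i)"
  shows "T \<xi>s = 0"
proof -
  have "T \<xi>s = 0" if "k \<le> n" "length \<xi>s = n" "\<And>i. i < k \<Longrightarrow> \<xi>s ! i \<in> span (A i)"
    "\<And>i. k \<le> i \<Longrightarrow> i < n \<Longrightarrow> \<xi>s ! i \<in> A i" for k \<xi>s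
    using that
  proof (induction k arbitrary: \<xi>s)
    case 0
    then show ?case
      by (auto intro: zero)
  next
    case (Suc k)
    have "T (\<xi>s[k := \<eta>]) = 0" if "\<eta> \<in> span (A k)" for \<eta>
    proof -
      have "span (A k) \<subseteq> {\<eta>. T (\<xi>s[k := \<eta>]) = 0}"
      proof (rule span_minimal)
        show "A k \<subseteq> {\<eta>. T (\<xi>s[k := \<eta>]) = 0}"
        proof safe
          fix \<eta> assume \<eta>: "\<eta> \<in> A k"
          show "T (\<xi>s[k := \<eta>]) = 0"
          proof (rule Suc.IH)
            fix i assume "k \<le> i" "i < n"
            then show "\<xi>s[k := \<eta>] ! i \<in> A i"
              using \<eta> Suc.prems by (cases "i = k") auto
          qed (use Suc.prems in auto)
        qed
        show "subspace {\<eta>. T (\<xi>s[k := \<eta>]) = 0}"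
          using linear_subspace_kernel[OF multivector_linear[OF T]] Suc.prems by (auto simp: Suc_le_eq)
      qed
      with that show ?thesis
        by auto
    qed
    from this[of "\<xi>s ! k"] show ?case
      using Suc.prems(3)[of k] by simp
  qed
  from this[of n] \<xi>s show ?thesis
    by auto
qed

section \<open>Decomposable multivectors\<close>

lemma prod_update_row:
  assumes "length \<xi>s = n" "i < n"
  shows "(\<Prod>l<n. blinfun_apply (\<xi>s[i := \<eta>] ! l) (v l)) =
    blinfun_apply \<eta> (v i) * (\<Prod>l\<in>{..<n} - {i}. blinfun_apply (\<xi>s ! l) (v l))"
proof -
  have "(\<Prod>l<n. blinfun_apply (\<xi>s[i := \<eta>] ! l) (v l)) =
    blinfun_apply (\<xi>s[i := \<eta>] ! i) (v i) * (\<Prod>l\<in>{..<n} - {i}. blinfun_apply (\<xi>s[i := \<eta>] ! l) (v l))"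
    using assms by (intro prod.remove) auto
  also have "(\<Prod>l\<in>{..<n} - {i}. blinfun_apply (\<xi>s[i := \<eta>] ! l) (v l)) =
      (\<Prod>l\<in>{..<n} - {i}. blinfun_apply (\<xi>s ! l) (v l))"
    by (rule prod.cong) auto
  finally show ?thesis
    using assms by simp
qed

text \<open>Alternation: precomposition with the transposition of two equal rows is an involution of the
  index set of the sum which changes the sign of each summand.\<close>

lemma multivector_wedge: "multivector (length vs) (wedge vs)"
  unfolding multivector_def
proof (intro conjI allI impI; (elim conjE)?)
  fix \<xi>s :: "('a \<Rightarrow>\<^sub>L real) list" and i
  assume len: "length \<xi>s = length vs" and i: "i < length vs"
  show "linear (\<lambda>\<eta>. wedge vs (\<xi>s[i := \<eta>]))"
    by (rule linearI)
      (simp_all add: wedge_def len prod_update_row[OF len i] blinfun.add_left blinfun.scaleR_left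
        algebra_simps sum.distrib sum_distrib_left)
next
  fix \<xi>s :: "('a \<Rightarrow>\<^sub>L real) list" and i j
  assume len: "length \<xi>s = length vs" and ij: "i < j" "j < length vs" and eq: "\<xi>s ! i = \<xi>s ! j"
  define n where "n = length vs"
  define \<tau> where "\<tau> = Transposition.transpose i j"
  have \<tau>: "\<tau> permutes {..<n}"
    unfolding \<tau>_def n_def using ij by (intro permutes_swap_id) auto
  define f where "f \<pi> = of_int (sign \<pi>) * (\<Prod>l<n. blinfun_apply (\<xi>s ! l) (vs ! \<pi> l))" for \<pi>
  have neg: "f (\<pi> \<circ> \<tau>) = - f \<pi>" if \<pi>: "\<pi> permutes {..<n}" for \<pi>
  proof -
    have "sign (\<pi> \<circ> \<tau>) = sign \<pi> * sign \<tau>"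
      by (rule sign_compose) (use \<pi> \<tau> permutation_permutes in blast)+
    then have s: "sign (\<pi> \<circ> \<tau>) = - sign \<pi>"
      using ij by (simp add: \<tau>_def sign_swap_id)
    have row: "\<xi>s ! \<tau> l = \<xi>s ! l" for l
      using eq by (auto simp: \<tau>_def Transposition.transpose_def)
    have "(\<Prod>l<n. blinfun_apply (\<xi>s ! l) (vs ! \<pi> l)) =
        prod ((\<lambda>l. blinfun_apply (\<xi>s ! l) (vs ! \<pi> l)) \<circ> \<tau>) {..<n}"
      by (rule prod.permute[OF \<tau>])
    then show ?thesis
      by (simp add: f_def s row)
  qed
  have "sum f {\<pi>. \<pi> permutes {..<n}} = sum (\<lambda>\<pi>. f (\<pi> \<circ> \<tau>)) {\<pi>. \<pi> permutes {..<n}}"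
    by (rule sum_permutations_compose_right[OF \<tau>])
  also have "\<dots> = - sum f {\<pi>. \<pi> permutes {..<n}}"
    by (simp add: neg sum_negf)
  finally show "wedge vs \<xi>s = 0"
    by (simp add: wedge_def len f_def n_def)
qed (simp add: wedge_def)

text \<open>A permutation other than the identity moves some row before the last one, and picks an
  off-diagonal zero there.\<close>

lemma wedge_unitriangular:
  assumes len: "length \<xi>s = length vs"
    and diag: "\<And>i j. i < length vs \<Longrightarrow> j < length vs \<Longrightarrow> Suc i < length vs \<Longrightarrow>
      blinfun_apply (\<xi>s ! i) (vs ! j) = (if i = j then 1 else 0)"
    and nonempty: "vs \<noteq> []"
  shows "wedge vs \<xi>s = blinfun_apply (last \<xi>s) (last vs)"
proof -
  define n where "n = length vs"
  have n: "n > 0" using nonempty by (simp add: n_def)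
  have zero: "(\<Prod>i<n. blinfun_apply (\<xi>s ! i) (vs ! \<pi> i)) = 0"
    if \<pi>: "\<pi> permutes {..<n}" "\<pi> \<noteq> id" for \<pi>
  proof -
    have "\<exists>i. Suc i < n \<and> \<pi> i \<noteq> i"
    proof (rule ccontr)
      assume "\<not> ?thesis"
      then have fix_i: "\<pi> i = i" if "i \<noteq> n - 1" for i
        using that \<pi>(1) permutes_not_in[OF \<pi>(1), of i] by (cases "i < n") auto
      moreover have "\<pi> (n - 1) = n - 1"
        by (metis \<pi>(1) fix_i permutes_def)
      ultimately have "\<pi> = id"
        by (intro ext) (metis id_apply)
      with \<pi>(2) show False by simp
    qed
    then obtain i where i: "Suc i < n" "\<pi> i \<noteq> i" by blast
    have "\<pi> i < n"
      using permutes_in_image[OF \<pi>(1), of i] i by auto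
    then have "blinfun_apply (\<xi>s ! i) (vs ! \<pi> i) = 0"
      using diag[of i "\<pi> i"] i by (auto simp: n_def)
    then show ?thesis
      using i by (intro prod_zero) (auto intro!: bexI[of _ i])
  qed
  have "wedge vs \<xi>s = (\<Sum>\<pi> | \<pi> permutes {..<n}.
      of_int (sign \<pi>) * (\<Prod>i<n. blinfun_apply (\<xi>s ! i) (vs ! \<pi> i)))"
    by (simp add: wedge_def len n_def)
  also have "\<dots> = (\<Sum>\<pi> \<in> {id}. of_int (sign \<pi>) * (\<Prod>i<n. blinfun_apply (\<xi>s ! i) (vs ! \<pi> i)))"
    by (rule sum.mono_neutral_right) (auto simp: zero finite_permutations permutes_id)
  also have "\<dots> = (\<Prod>i<n. blinfun_apply (\<xi>s ! i) (vs ! i))"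
    by (simp add: sign_id)
  also have "\<dots> = (\<Prod>i<Suc (n - 1). blinfun_apply (\<xi>s ! i) (vs ! i))"
    using n by simp
  also have "\<dots> = blinfun_apply (\<xi>s ! (n - 1)) (vs ! (n - 1))"
    unfolding prod.lessThan_Suc using diag by (simp add: n_def)
  finally show ?thesis
    using len nonempty last_conv_nth[of \<xi>s] last_conv_nth[of vs] n by (cases \<xi>s) (auto simp: n_def)
qed

lemma wedge_zero_row:
  assumes "i < length \<xi>s" "\<And>v. v \<in> set vs \<Longrightarrow> blinfun_apply (\<xi>s ! i) v = 0"
  shows "wedge vs \<xi>s = 0"
proof (cases "length \<xi>s = length vs")
  case True
  have "(\<Prod>l<length vs. blinfun_apply (\<xi>s ! l) (vs ! \<pi> l)) = 0" if "\<pi> permutes {..<length vs}" for \<pi>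
    using assms True permutes_in_image[OF that, of i] by (intro prod_zero) (auto intro!: bexI[of _ i])
  then have "(\<Sum>\<pi> | \<pi> permutes {..<length vs}. real_of_int (sign \<pi>) *
      (\<Prod>l<length vs. blinfun_apply (\<xi>s ! l) (vs ! \<pi> l))) = 0"
    by (intro sum.neutral) simp
  then show ?thesis
    by (simp add: wedge_def True)
qed (simp add: wedge_def)

text \<open>Two rows that live in the last column only are proportional.\<close>

lemma wedge_two_rows_off_last:
  assumes "i < length \<xi>s" "j < length \<xi>s" "i \<noteq> j"
    and "\<And>v. v \<in> set vs \<Longrightarrow> blinfun_apply (\<xi>s ! i) v = 0"
    and "\<And>v. v \<in> set vs \<Longrightarrow> blinfun_apply (\<xi>s ! j) v = 0"
  shows "wedge (vs @ [w]) \<xi>s = 0"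
proof (cases "length \<xi>s = Suc (length vs)")
  case True
  let ?n = "Suc (length vs)"
  have "(\<Prod>l<?n. blinfun_apply (\<xi>s ! l) ((vs @ [w]) ! \<pi> l)) = 0" if \<pi>: "\<pi> permutes {..<?n}" for \<pi>
  proof -
    obtain l where l: "l = i \<or> l = j" "\<pi> l \<noteq> length vs"
      using assms(3) permutes_inj[OF \<pi>] by (metis injD)
    then have "\<pi> l < length vs"
      using assms True permutes_in_image[OF \<pi>, of l] by auto
    then have "blinfun_apply (\<xi>s ! l) ((vs @ [w]) ! \<pi> l) = 0"
      using l(1) assms(4,5) by (auto simp: nth_append)
    then show ?thesis
      using assms l True by (intro prod_zero) (auto intro!: bexI[of _ l])
  qed
  then have "(\<Sum>\<pi> | \<pi> permutes {..<?n}. real_of_int (sign \<pi>) *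
      (\<Prod>l<?n. blinfun_apply (\<xi>s ! l) ((vs @ [w]) ! \<pi> l))) = 0"
    by (intro sum.neutral) (simp del: prod.lessThan_Suc)
  then show ?thesis
    by (simp add: wedge_def True del: prod.lessThan_Suc)
qed (simp add: wedge_def)

section \<open>Linear coordinates\<close>

lemma blinfun_apply_Blinfun_linear:
  fixes f :: "'v::euclidean_space \<Rightarrow> real"
  assumes "linear f"
  shows "blinfun_apply (Blinfun f) = f"
  using assms by (simp add: bounded_linear_Blinfun_apply linear_conv_bounded_linear)

lemma covector_sum_Basis:
  fixes \<xi> :: "'v::euclidean_space \<Rightarrow>\<^sub>L real"
  shows "\<xi> = (\<Sum>b\<in>Basis. blinfun_apply \<xi> b *\<^sub>R blinfun_inner_left b)"
proof (rule blinfun_eqI)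
  fix v :: 'v
  have "blinfun_apply \<xi> v = blinfun_apply \<xi> (\<Sum>b\<in>Basis. (v \<bullet> b) *\<^sub>R b)"
    by (simp add: euclidean_representation)
  then show "blinfun_apply \<xi> v =
      blinfun_apply (\<Sum>b\<in>Basis. blinfun_apply \<xi> b *\<^sub>R blinfun_inner_left b) v"
    by (simp add: blinfun.sum_right blinfun.scaleR_right blinfun.sum_left blinfun.scaleR_left mult.commute)
qed

text \<open>Reflexivity of a finite-dimensional space, in the form that turns a dual basis of the
  space of covectors into a basis of vectors.\<close>

lemma covector_functional_is_evaluation:
  fixes f :: "('v::euclidean_space \<Rightarrow>\<^sub>L real) \<Rightarrow> real"
  assumes "linear f"
  obtains e where "\<And>\<xi>. f \<xi> = blinfun_apply \<xi> e"
proof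
  fix \<xi> :: "'v \<Rightarrow>\<^sub>L real"
  have "f \<xi> = f (\<Sum>b\<in>Basis. blinfun_apply \<xi> b *\<^sub>R blinfun_inner_left b)"
    by (subst covector_sum_Basis) simp
  also have "\<dots> = blinfun_apply \<xi> (\<Sum>b\<in>Basis. f (blinfun_inner_left b) *\<^sub>R b)"
    by (simp add: linear_sum[OF assms] linear_cmul[OF assms] blinfun.sum_right blinfun.scaleR_right
        mult.commute)
  finally show "f \<xi> = blinfun_apply \<xi> (\<Sum>b\<in>Basis. f (blinfun_inner_left b) *\<^sub>R b)" .
qed

text \<open>The Riesz isomorphism transports bases to the Euclidean space, where the dimension is known.\<close>

lemma covector_basis_card:
  fixes B :: "('v::euclidean_space \<Rightarrow>\<^sub>L real) set"
  assumes "independent B" "span B = UNIV"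
  shows "finite B \<and> card B = DIM('v)"
proof -
  define \<Psi> :: "('v \<Rightarrow>\<^sub>L real) \<Rightarrow> 'v" where "\<Psi> \<xi> = (\<Sum>b\<in>Basis. blinfun_apply \<xi> b *\<^sub>R b)" for \<xi>
  have lin: "linear \<Psi>"
    by (rule linearI) (simp_all add: \<Psi>_def blinfun.add_left blinfun.scaleR_left scaleR_add_left
        sum.distrib scaleR_sum_right)
  have left: "blinfun_inner_left (\<Psi> \<xi>) = \<xi>" for \<xi>
    by (subst (2) covector_sum_Basis)
      (simp add: \<Psi>_def bounded_linear.linear[OF bounded_linear_blinfun_inner_left] linear_sum
        linear_cmul)
  then have inj: "inj \<Psi>"
    by (rule inj_on_inverseI)
  have "\<Psi> (blinfun_inner_left v) = v" for v
    by (simp add: \<Psi>_def inner_commute[of _ v] euclidean_representation)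
  then have surj: "surj \<Psi>"
    by (metis surjI)
  have ind: "independent (\<Psi> ` B)"
    by (rule linear_independent_injective_image[OF lin assms(1)]) (use inj in \<open>auto intro: inj_on_subset\<close>)
  have "span (\<Psi> ` B) = UNIV"
    using linear_span_image[OF lin, of B] assms(2) surj by simp
  then have "card (\<Psi> ` B) = dim (UNIV :: 'v set)"
    using basis_card_eq_dim[of "\<Psi> ` B" UNIV] ind by simp
  moreover have "finite (\<Psi> ` B)"
    using ind by (rule finiteI_independent)
  ultimately show ?thesis
    using inj by (simp add: card_image finite_image_iff inj_on_subset[OF inj])
qed

text \<open>The tool which produces all coordinate systems below: prescribed covectors with dual functionals
  \<open>d i\<close> become the first coordinates, and the other coordinates are taken from the common kernel of the
  \<open>d i\<close>, which is a complement of the span of the prescribed covectors.\<close>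

lemma adapted_coordinates:
  fixes \<zeta>s :: "((real ^ 'm) \<Rightarrow>\<^sub>L real) list" and d :: "nat \<Rightarrow> ((real ^ 'm) \<Rightarrow>\<^sub>L real) \<Rightarrow> real"
  assumes lin: "\<And>i. i < length \<zeta>s \<Longrightarrow> linear (d i)"
    and dual: "\<And>i j. i < length \<zeta>s \<Longrightarrow> j < length \<zeta>s \<Longrightarrow> d i (\<zeta>s ! j) = (if i = j then 1 else 0)"
  obtains X :: "nat \<Rightarrow> ((real ^ 'm) \<Rightarrow>\<^sub>L real)" and e :: "nat \<Rightarrow> real ^ 'm" where
    "linear_coordinates (\<lambda>i. blinfun_apply (X i)) e"
    "span (X ` {1..CARD('m)}) = UNIV"
    "length \<zeta>s \<le> CARD('m)"
    "\<And>i. i < length \<zeta>s \<Longrightarrow> X (Suc i) = \<zeta>s ! i"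
    "\<And>i j. i < length \<zeta>s \<Longrightarrow> length \<zeta>s < j \<Longrightarrow> j \<le> CARD('m) \<Longrightarrow> d i (X j) = 0"
proof -
  define r where "r = length \<zeta>s"
  define L where "L = {\<xi>. \<forall>i<r. d i \<xi> = 0}"
  have sub: "subspace L"
    unfolding L_def subspace_def using lin by (auto simp: r_def linear_0 linear_add linear_cmul)
  obtain C where C: "C \<subseteq> L" "independent C" "L \<subseteq> span C"
    using maximal_independent_subset by blast
  have indk: "independent ((!) \<zeta>s ` {..<k} \<union> C)" if "k \<le> r" for k
    using that
  proof (induction k)
    case (Suc k)
    have "span ((!) \<zeta>s ` {..<k} \<union> C) \<subseteq> {\<xi>. d k \<xi> = 0}"
    proof (rule span_minimal)
      show "subspace {\<xi>. d k \<xi> = 0}"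
        using lin Suc.prems by (intro linear_subspace_kernel) (auto simp: r_def)
      show "(!) \<zeta>s ` {..<k} \<union> C \<subseteq> {\<xi>. d k \<xi> = 0}"
        using C(1) Suc.prems dual by (auto simp: L_def r_def)
    qed
    moreover have "d k (\<zeta>s ! k) \<noteq> 0"
      using dual Suc.prems by (auto simp: r_def)
    ultimately have "\<zeta>s ! k \<notin> span ((!) \<zeta>s ` {..<k} \<union> C)"
      by auto
    with Suc show ?case
      using independent_insertI by (simp add: lessThan_Suc)
  qed (use C in simp)
  define B where "B = set \<zeta>s \<union> C"
  have image: "(!) \<zeta>s ` {..<r} = set \<zeta>s"
    by (auto simp: r_def in_set_conv_nth)
  have indB: "independent B"
    using indk[of r] by (simp add: B_def image)
  have spanB: "span B = UNIV"
  proof -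
    have "\<xi> \<in> span B" for \<xi>
    proof -
      define \<kappa> where "\<kappa> = \<xi> - (\<Sum>j<r. d j \<xi> *\<^sub>R \<zeta>s ! j)"
      have "d i \<kappa> = 0" if "i < r" for i
      proof -
        have l: "linear (d i)" using lin that by (simp add: r_def)
        have "d i \<kappa> = d i \<xi> - (\<Sum>j<r. d j \<xi> * (if i = j then 1 else 0))"
          using that dual by (simp add: \<kappa>_def linear_diff[OF l] linear_sum[OF l] linear_cmul[OF l] r_def)
        then show ?thesis using that by (simp add: if_distrib[of "(*) _"] cong: if_cong)
      qed
      then have "\<kappa> \<in> span B"
        using C(3) span_mono[of C B] by (auto simp: L_def B_def)
      moreover have "(\<Sum>j<r. d j \<xi> *\<^sub>R \<zeta>s ! j) \<in> span B"
        by (intro span_sum span_scale span_base) (auto simp: B_def r_def)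
      ultimately have "\<kappa> + (\<Sum>j<r. d j \<xi> *\<^sub>R \<zeta>s ! j) \<in> span B"
        by (rule span_add)
      then show ?thesis by (simp add: \<kappa>_def)
    qed
    then show ?thesis by auto
  qed
  have cardB: "finite B" "card B = CARD('m)"
    using covector_basis_card[OF indB spanB] by auto
  have disj: "set \<zeta>s \<inter> C = {}"
  proof safe
    fix \<xi> assume "\<xi> \<in> set \<zeta>s" "\<xi> \<in> C"
    then obtain i where "i < r" "\<xi> = \<zeta>s ! i" "d i \<xi> = 0"
      using C(1) by (auto simp: in_set_conv_nth L_def r_def)
    then show "\<xi> \<in> {}"
      using dual[of i i] by (simp add: r_def)
  qed
  have dist\<zeta>: "distinct \<zeta>s"
    using dual by (auto simp: distinct_conv_nth) (metis zero_neq_one)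
  obtain cs where cs: "set cs = C" "distinct cs"
    using finite_distinct_list[of C] cardB(1) by (auto simp: B_def)
  define ys where "ys = \<zeta>s @ cs"
  have ys: "set ys = B" "distinct ys"
    using cs dist\<zeta> disj by (auto simp: ys_def B_def)
  then have len: "length ys = CARD('m)"
    using cardB distinct_card by metis
  define X where "X i = ys ! (i - 1)" for i
  have XB: "X ` {1..CARD('m)} = B"
  proof -
    have "X ` {1..CARD('m)} = X ` Suc ` {..<CARD('m)}"
      by (metis image_Suc_lessThan)
    also have "\<dots> = (!) ys ` {..<CARD('m)}"
      by (simp add: image_image X_def)
    also have "\<dots> = B"
      by (auto simp: set_conv_nth len simp flip: ys(1))
    finally show ?thesis .
  qed
  have "\<exists>e. \<forall>i\<in>{1..CARD('m)}. blinfun_apply (X i) e = (if i = j then 1 else 0)"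
    if j: "j \<in> {1..CARD('m)}" for j
  proof -
    obtain f where f: "linear f" "\<And>x. x \<in> B \<Longrightarrow> f x = (if x = X j then 1 else 0 :: real)"
      using linear_independent_extend[OF indB, of "\<lambda>x. if x = X j then 1 else 0"] by blast
    obtain e where e: "\<And>\<xi>. f \<xi> = blinfun_apply \<xi> e"
      using covector_functional_is_evaluation[OF f(1)] by blast
    have "blinfun_apply (X i) e = (if i = j then 1 else 0)" if i: "i \<in> {1..CARD('m)}" for i
    proof -
      have "X i \<in> B" using XB i by blast
      moreover have "X i = X j \<longleftrightarrow> i = j"
        using i j ys(2) len by (auto simp: X_def nth_eq_iff_index_eq)
      ultimately show ?thesis
        using f(2) e by metis
    qed
    then show ?thesis by blast
  qed
  then obtain e where e: "\<And>i j. i \<in> {1..CARD('m)} \<Longrightarrow> j \<in> {1..CARD('m)} \<Longrightarrow>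
      blinfun_apply (X i) (e j) = (if i = j then 1 else 0)"
    by metis
  show ?thesis
  proof
    show "linear_coordinates (\<lambda>i. blinfun_apply (X i)) e"
      using e by (simp add: linear_coordinates_def bounded_linear.linear[OF blinfun.bounded_linear_right])
    show "span (X ` {1..CARD('m)}) = UNIV"
      by (simp only: XB spanB)
    show "length \<zeta>s \<le> CARD('m)"
      using len by (simp add: ys_def)
    show "X (Suc i) = \<zeta>s ! i" if "i < length \<zeta>s" for i
      using that by (simp add: X_def ys_def nth_append)
    show "d i (X j) = 0" if "i < length \<zeta>s" "length \<zeta>s < j" "j \<le> CARD('m)" for i j
    proof -
      have "X j \<in> set cs"
        using that len by (auto simp: X_def ys_def nth_append)
      with cs C(1) that(1) show ?thesis by (auto simp: L_def r_def)
    qed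
  qed
qed

lemma covector_expansion:
  fixes X :: "nat \<Rightarrow> ((real ^ 'm) \<Rightarrow>\<^sub>L real)"
  assumes coords: "linear_coordinates (\<lambda>i. blinfun_apply (X i)) e"
    and span: "span (X ` {1..CARD('m)}) = UNIV"
  shows "\<xi> = (\<Sum>j=1..CARD('m). blinfun_apply \<xi> (e j) *\<^sub>R X j)"
proof -
  have dual: "blinfun_apply (X i) (e j) = (if i = j then 1 else 0)"
    if "i \<in> {1..CARD('m)}" "j \<in> {1..CARD('m)}" for i j
    using coords that by (simp add: linear_coordinates_def)
  let ?R = "\<lambda>\<xi>. (\<Sum>j=1..CARD('m). blinfun_apply \<xi> (e j) *\<^sub>R X j)"
  have lin: "linear (\<lambda>\<xi>. \<xi> - ?R \<xi>)"
    by (rule linearI) (simp_all add: blinfun.add_left blinfun.scaleR_left scaleR_add_left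
        sum.distrib scaleR_sum_right scaleR_diff_right)
  have "X i - ?R (X i) = 0" if "i \<in> {1..CARD('m)}" for i
  proof -
    have "?R (X i) = (\<Sum>j=1..CARD('m). if i = j then X j else 0)"
      using that dual by (intro sum.cong) auto
    then show ?thesis using that by simp
  qed
  then have "span (X ` {1..CARD('m)}) \<subseteq> {\<xi>. \<xi> - ?R \<xi> = 0}"
    by (intro span_minimal linear_subspace_kernel lin) auto
  then have "\<xi> \<in> {\<xi>. \<xi> - ?R \<xi> = 0}"
    using span by blast
  then show ?thesis by simp
qed

text \<open>Expand each argument in the basis; lists of basis covectors with a repetition give 0 on both
  sides.\<close>

lemma multivector_eqI:
  assumes T: "multivector n T" and S: "multivector n S"
    and span: "span (X ` {1..m}) = UNIV"
    and eq: "\<And>is. length is = n \<Longrightarrow> distinct is \<Longrightarrow> set is \<subseteq> {1..m::nat} \<Longrightarrow>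
      T (map X is) = S (map X is)"
  shows "T = S"
proof
  fix \<xi>s
  show "T \<xi>s = S \<xi>s"
  proof (cases "length \<xi>s = n")
    case True
    have "T \<xi>s - S \<xi>s = 0"
    proof (rule multivector_zero_on_span[OF multivector_diff[OF T S], where A = "\<lambda>_. X ` {1..m}"])
      fix \<xi>s :: "('a \<Rightarrow>\<^sub>L real) list"
      assume len: "length \<xi>s = n" and "\<And>i. i < n \<Longrightarrow> \<xi>s ! i \<in> X ` {1..m}"
      then have set: "set \<xi>s \<subseteq> X ` {1..m}"
        by (auto simp: in_set_conv_nth)
      define js where "js = map (inv_into {1..m} X) \<xi>s"
      have js: "\<xi>s = map X js" "length js = n" "set js \<subseteq> {1..m}"
        using set len inv_into_into[of _ X "{1..m}"]
        by (auto simp: js_def f_inv_into_f subset_iff intro!: map_idI[symmetric])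
      show "T \<xi>s - S \<xi>s = 0"
      proof (cases "distinct js")
        case True
        then show ?thesis using eq js by simp
      next
        case False
        then have "\<not> distinct \<xi>s"
          by (simp add: js(1) distinct_map)
        then show ?thesis
          by (simp add: multivector_not_distinct[OF T] multivector_not_distinct[OF S])
      qed
    qed (use True span in auto)
    then show ?thesis by simp
  qed (simp add: multivector_length[OF T] multivector_length[OF S])
qed

section \<open>Differentials of linear and quadratic functions\<close>

lemma differentialI:
  assumes "(f has_derivative blinfun_apply D) (at p)"
  shows "differential f p = D"
  using frechet_derivative_at[OF assms] blinfun_apply_inverse[of D]
  by (simp add: differential_def)

lemma differential_covector: "differential (blinfun_apply \<xi>) p = \<xi>"
  by (rule differentialI) (rule bounded_linear_imp_has_derivative[OF blinfun.bounded_linear_right])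

lemma differential_quadratic:
  assumes "finite J"
  shows "differential (\<lambda>v. \<Sum>j\<in>J. c j * blinfun_apply (\<xi> j) v * blinfun_apply (\<eta> j) v) p =
    (\<Sum>j\<in>J. (c j * blinfun_apply (\<xi> j) p) *\<^sub>R \<eta> j + (c j * blinfun_apply (\<eta> j) p) *\<^sub>R \<xi> j)"
proof (rule differentialI)
  show "((\<lambda>v. \<Sum>j\<in>J. c j * blinfun_apply (\<xi> j) v * blinfun_apply (\<eta> j) v) has_derivative
    blinfun_apply (\<Sum>j\<in>J. (c j * blinfun_apply (\<xi> j) p) *\<^sub>R \<eta> j + (c j * blinfun_apply (\<eta> j) p) *\<^sub>R \<xi> j)) (at p)"
    by (rule has_derivative_eq_rhs)
      (auto intro!: derivative_eq_intros simp: blinfun.sum_left blinfun.add_left blinfun.scaleR_left algebra_simps)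
qed

lemma differential_square:
  "differential (\<lambda>v. blinfun_apply \<xi> v * blinfun_apply \<eta> v) p =
    blinfun_apply \<xi> p *\<^sub>R \<eta> + blinfun_apply \<eta> p *\<^sub>R \<xi>"
  using differential_quadratic[of "{()}" "\<lambda>_. 1" "\<lambda>_. \<xi>" "\<lambda>_. \<eta>" p] by simp

lemma C_k_affine:
  fixes \<xi> :: "'v::real_normed_vector \<Rightarrow>\<^sub>L real"
  shows "C_k k (\<lambda>v. c + blinfun_apply \<xi> v)"
proof (induction k arbitrary: c \<xi>)
  case (Suc k)
  have der: "((\<lambda>v. c + blinfun_apply \<xi> v) has_derivative blinfun_apply \<xi>) (at p)" for p
    by (auto intro!: derivative_eq_intros)
  have "C_k k (\<lambda>p::'v. blinfun_apply \<xi> u)" for u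
    using Suc[of "blinfun_apply \<xi> u" 0] by simp
  then show ?case
    using der by (auto simp: differentiable_def simp flip: frechet_derivative_at[OF der])
qed (auto intro!: continuous_intros)

lemma smooth_covector: "smooth_function (blinfun_apply \<xi>)"
  using C_k_affine[of _ 0 \<xi>] by (simp add: smooth_function_def)

lemma smooth_square: "smooth_function (\<lambda>v. blinfun_apply \<xi> v * blinfun_apply \<xi> v)"
  unfolding smooth_function_def
proof
  fix k
  show "C_k k (\<lambda>v. blinfun_apply \<xi> v * blinfun_apply \<xi> v)"
  proof (cases k)
    case (Suc l)
    have der: "((\<lambda>v. blinfun_apply \<xi> v * blinfun_apply \<xi> v) has_derivative
        (\<lambda>u. 2 * blinfun_apply \<xi> p * blinfun_apply \<xi> u)) (at p)" for p
      by (auto intro!: derivative_eq_intros)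
    have "C_k l (\<lambda>p. 2 * blinfun_apply \<xi> p * blinfun_apply \<xi> u)" for u
      using C_k_affine[of l 0 "(2 * blinfun_apply \<xi> u) *\<^sub>R \<xi>"]
      by (simp add: blinfun.scaleR_left mult_ac)
    then show ?thesis
      using der by (auto simp: Suc differentiable_def simp flip: frechet_derivative_at[OF der])
  qed (auto intro!: continuous_intros)
qed

section \<open>The Filippov identity on covectors\<close>

text \<open>The bracket of linear functions is linear, so a linear tensor defines an \<open>n\<close>-ary operation on
  covectors.\<close>

definition bracket ::
    "('v::euclidean_space \<Rightarrow> ('v \<Rightarrow>\<^sub>L real) list \<Rightarrow> real) \<Rightarrow> ('v \<Rightarrow>\<^sub>L real) list \<Rightarrow> 'v \<Rightarrow>\<^sub>L real" where
  "bracket \<Lambda> \<xi>s = Blinfun (\<lambda>p. \<Lambda> p \<xi>s)"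

locale linear_multivector =
  fixes n :: nat and \<Lambda> :: "'v::euclidean_space \<Rightarrow> ('v \<Rightarrow>\<^sub>L real) list \<Rightarrow> real"
  assumes multivector: "multivector n (\<Lambda> p)"
    and linear: "linear (\<lambda>p. \<Lambda> p \<xi>s)"
begin

lemma bracket_apply: "blinfun_apply (bracket \<Lambda> \<xi>s) p = \<Lambda> p \<xi>s"
  by (simp add: bracket_def blinfun_apply_Blinfun_linear[OF linear])

lemma nambu_bracket_covectors:
  "nambu_bracket \<Lambda> (map blinfun_apply \<xi>s) = blinfun_apply (bracket \<Lambda> \<xi>s)"
  by (auto simp: nambu_bracket_def bracket_apply o_def differential_covector)

lemma filippov_covectors:
  assumes np: "nambu_poisson n \<Lambda>" and len: "Suc (length F) = n" "length G = n"
  shows "\<Lambda> p (F @ [bracket \<Lambda> G]) = (\<Sum>i<n. \<Lambda> p (G[i := bracket \<Lambda> (F @ [G ! i])]))"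
proof -
  have "nambu_bracket \<Lambda> (map blinfun_apply F @ [nambu_bracket \<Lambda> (map blinfun_apply G)]) p =
      (\<Sum>i<n. nambu_bracket \<Lambda> ((map blinfun_apply G)[i :=
        nambu_bracket \<Lambda> (map blinfun_apply F @ [map blinfun_apply G ! i])]) p)"
    using np len by (simp add: nambu_poisson_def smooth_covector ball_Un)
  moreover have "map blinfun_apply F @ [blinfun_apply \<xi>] = map blinfun_apply (F @ [\<xi>])" for \<xi>
    by simp
  ultimately show ?thesis
    using len by (simp add: nambu_bracket_covectors bracket_apply map_update[symmetric]
        del: map_append)
qed

text \<open>The principal part of the Filippov identity. Inserting the square of a linear function \<open>\<alpha>\<close> and
  subtracting \<open>2\<alpha>\<close> times the identity for \<open>\<alpha>\<close> leaves the terms in which the inner bracket is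
  not differentiated, and these are algebraic at each point.\<close>

lemma square_identity:
  assumes np: "nambu_poisson n \<Lambda>" and len: "Suc (Suc (length f)) = n" "length G = n"
  shows "(\<Sum>i<n. \<Lambda> p (\<alpha> # f @ [G ! i]) * \<Lambda> p (G[i := \<alpha>])) = 0"
proof -
  define sq where "sq v = blinfun_apply \<alpha> v * blinfun_apply \<alpha> v" for v
  define \<beta> where "\<beta> i = bracket \<Lambda> (\<alpha> # f @ [G ! i])" for i
  have sq: "nambu_bracket \<Lambda> (sq # map blinfun_apply f @ [blinfun_apply \<xi>]) v =
      2 * blinfun_apply \<alpha> v * blinfun_apply (bracket \<Lambda> (\<alpha> # f @ [\<xi>])) v" for \<xi> v
  proof -
    have "differential sq v = (2 * blinfun_apply \<alpha> v) *\<^sub>R \<alpha>"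
      unfolding sq_def by (simp add: differential_square flip: scaleR_add_left)
    then have "nambu_bracket \<Lambda> (sq # map blinfun_apply f @ [blinfun_apply \<xi>]) v =
        \<Lambda> v ((\<alpha> # f @ [\<xi>])[0 := (2 * blinfun_apply \<alpha> v) *\<^sub>R \<alpha>])"
      by (simp add: nambu_bracket_def differential_covector o_def)
    also have "\<dots> = 2 * blinfun_apply \<alpha> v * \<Lambda> v (\<alpha> # f @ [\<xi>])"
      using linear_cmul[OF multivector_linear[OF multivector[of v], of "\<alpha> # f @ [\<xi>]" 0]] len by simp
    finally show ?thesis by (simp add: bracket_apply)
  qed
  have "nambu_bracket \<Lambda> ((sq # map blinfun_apply f) @ [nambu_bracket \<Lambda> (map blinfun_apply G)]) p =
      (\<Sum>i<n. nambu_bracket \<Lambda> ((map blinfun_apply G)[i :=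
        nambu_bracket \<Lambda> ((sq # map blinfun_apply f) @ [map blinfun_apply G ! i])]) p)"
  proof -
    have "smooth_function sq"
      unfolding sq_def by (rule smooth_square)
    then show ?thesis
      using len by (intro np[unfolded nambu_poisson_def, THEN conjunct2, rule_format])
        (auto simp: smooth_covector)
  qed
  also have "\<dots> = (\<Sum>i<n. 2 * blinfun_apply \<alpha> p * \<Lambda> p (G[i := \<beta> i]) +
      2 * (\<Lambda> p (\<alpha> # f @ [G ! i]) * \<Lambda> p (G[i := \<alpha>])))"
  proof (rule sum.cong[OF refl])
    fix i assume "i \<in> {..<n}"
    then have i: "i < n" by simp
    define h where "h v = 2 * blinfun_apply \<alpha> v * blinfun_apply (\<beta> i) v" for v
    have "nambu_bracket \<Lambda> (sq # map blinfun_apply f @ [blinfun_apply (G ! i)]) = h"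
      by (auto simp: sq h_def \<beta>_def)
    moreover have "differential h p = (2 * blinfun_apply \<alpha> p) *\<^sub>R \<beta> i + (2 * blinfun_apply (\<beta> i) p) *\<^sub>R \<alpha>"
      using differential_quadratic[of "{()}" "\<lambda>_. 2" "\<lambda>_. \<alpha>" "\<lambda>_. \<beta> i" p] by (simp add: h_def[abs_def])
    moreover have "map (\<lambda>f. differential f p) ((map blinfun_apply G)[i := h]) = G[i := differential h p]"
      by (simp add: map_update o_def differential_covector)
    ultimately have "nambu_bracket \<Lambda> ((map blinfun_apply G)[i :=
        nambu_bracket \<Lambda> ((sq # map blinfun_apply f) @ [map blinfun_apply G ! i])]) p =
        \<Lambda> p (G[i := (2 * blinfun_apply \<alpha> p) *\<^sub>R \<beta> i + (2 * blinfun_apply (\<beta> i) p) *\<^sub>R \<alpha>])"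
      using i len by (simp add: nambu_bracket_def[of \<Lambda> "(map blinfun_apply G)[i := h]"])
    then show "nambu_bracket \<Lambda> ((map blinfun_apply G)[i :=
        nambu_bracket \<Lambda> ((sq # map blinfun_apply f) @ [map blinfun_apply G ! i])]) p =
        2 * blinfun_apply \<alpha> p * \<Lambda> p (G[i := \<beta> i]) +
        2 * (\<Lambda> p (\<alpha> # f @ [G ! i]) * \<Lambda> p (G[i := \<alpha>]))"
      using linear_add[OF multivector_linear[OF multivector[of p] len(2) i]]
        linear_cmul[OF multivector_linear[OF multivector[of p] len(2) i]]
      by (simp add: bracket_apply \<beta>_def)
  qed
  also have "\<dots> = 2 * blinfun_apply \<alpha> p * (\<Sum>i<n. \<Lambda> p (G[i := \<beta> i])) +
      2 * (\<Sum>i<n. \<Lambda> p (\<alpha> # f @ [G ! i]) * \<Lambda> p (G[i := \<alpha>]))"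
    by (simp add: sum.distrib sum_distrib_left)
  also have "(\<Sum>i<n. \<Lambda> p (G[i := \<beta> i])) = \<Lambda> p (\<alpha> # f @ [bracket \<Lambda> G])"
    using filippov_covectors[OF np, of "\<alpha> # f" G p] len by (simp add: \<beta>_def)
  also have "nambu_bracket \<Lambda> ((sq # map blinfun_apply f) @ [nambu_bracket \<Lambda> (map blinfun_apply G)]) p =
      2 * blinfun_apply \<alpha> p * \<Lambda> p (\<alpha> # f @ [bracket \<Lambda> G])"
    by (simp add: nambu_bracket_covectors sq bracket_apply)
  finally show ?thesis by simp
qed

end

section \<open>The quadratic identity forces decomposability\<close>

lemma mset_two_entries:
  assumes "l < length G" "l' < length G" "l \<noteq> l'"
  obtains f where "Suc (Suc (length f)) = length G" "mset G = mset (G ! l # f @ [G ! l'])"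
proof -
  define R where "R = take l G @ drop (Suc l) G"
  have G: "mset G = add_mset (G ! l) (mset R)"
    using arg_cong[OF id_take_nth_drop[OF assms(1)], of mset] by (simp add: R_def)
  have "G ! l' \<in> set R"
  proof (cases "l' < l")
    case True
    then show ?thesis
      using assms nth_mem[of l' "take l G"] by (simp add: R_def)
  next
    case False
    then show ?thesis
      using assms nth_mem[of "l' - Suc l" "drop (Suc l) G"] by (simp add: R_def)
  qed
  then obtain us vs where "R = us @ G ! l' # vs"
    by (meson split_list)
  then have m: "mset G = mset (G ! l # (us @ vs) @ [G ! l'])"
    using G by simp
  then have "length G = length (G ! l # (us @ vs) @ [G ! l'])"
    by (rule mset_eq_length)
  then show ?thesis
    using that[of "us @ vs"] m by simp
qed

lemma multivector_update_frame:
  assumes "multivector n T" "length a = n" "i < n" "j < n"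
  shows "T (a[i := a ! j]) = (if i = j then T a else 0)"
  using assms multivector_repeat[OF assms(1), of i "a[i := a ! j]" j] by auto

lemma multivector_update_diff:
  assumes "multivector n T" "length a = n" "i < n"
  shows "T (a[i := \<eta> - \<theta>]) = T (a[i := \<eta>]) - T (a[i := \<theta>])"
  by (rule linear_diff[OF multivector_linear[OF assms]])

lemma multivector_update_scale:
  assumes "multivector n T" "length a = n" "i < n"
  shows "T (a[i := c *\<^sub>R \<eta>]) = c * T (a[i := \<eta>])"
  using linear_cmul[OF multivector_linear[OF assms], of c \<eta>] by simp

lemma multivector_update_add:
  assumes "multivector n T" "length a = n" "i < n"
  shows "T (a[i := \<eta> + \<theta>]) = T (a[i := \<eta>]) + T (a[i := \<theta>])"
  by (rule linear_add[OF multivector_linear[OF assms]])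

lemma frame_projection_in_kernel:
  assumes T: "multivector n T" and a: "length a = n" "T a = 1" and l: "l < n"
  shows "T (a[l := \<xi> - (\<Sum>i<n. T (a[i := \<xi>]) *\<^sub>R a ! i)]) = 0"
proof -
  have "T (a[l := \<xi> - (\<Sum>i<n. T (a[i := \<xi>]) *\<^sub>R a ! i)]) =
      T (a[l := \<xi>]) - (\<Sum>i<n. T (a[i := \<xi>]) * (if l = i then 1 else 0))"
    unfolding multivector_update_diff[OF T a(1) l] multivector_update_sum[OF T a(1) l]
    using multivector_update_frame[OF T a(1) l] a by (simp cong: if_cong)
  then show ?thesis
    using l by (simp add: if_distrib[of "(*) _"] cong: if_cong)
qed

text \<open>A tensor with the quadratic identity is decomposable: if \<open>T a = 1\<close>, then every covector
  \<open>\<kappa>\<close> killed by the \<open>n\<close> vectors \<open>T(a\<^sub>1, \<dots>, \<cdot>, \<dots>, a\<^sub>n)\<close> annihilates \<open>T\<close>, that is, \<open>T\<close>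
  lives on the span of these vectors. The quadratic identity is polarized and then evaluated on two kinds
  of lists. With \<open>a\<close> itself it shows that \<open>T\<close> vanishes when a kernel covector and some \<open>a\<^sub>j\<close> occur
  together. This leaves the lists of kernel covectors only, and \<open>n > 2\<close> is decisive there: for
  \<open>n = 2\<close> the bivector \<open>\<partial>\<^sub>1 \<and> \<partial>\<^sub>2 + \<partial>\<^sub>3 \<and> \<partial>\<^sub>4\<close> satisfies the identity.\<close>

lemma kernel_of_nonzero_value:
  assumes n: "n > 2" and T: "multivector n T"
    and sq: "\<And>\<alpha> f G. Suc (Suc (length f)) = n \<Longrightarrow> length G = n \<Longrightarrow>
      (\<Sum>i<n. T (\<alpha> # f @ [G ! i]) * T (G[i := \<alpha>])) = 0"
    and a: "length a = n" "T a = 1"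
    and \<kappa>: "\<And>i. i < n \<Longrightarrow> T (a[i := \<kappa>]) = 0"
    and G: "length G = n" "l < n"
  shows "T (G[l := \<kappa>]) = 0"
proof -
  define K where "K = {\<kappa>. \<forall>i<n. T (a[i := \<kappa>]) = 0}"
  have polarized: "(\<Sum>i<n. T (\<beta> # f @ [G ! i]) * T (G[i := \<alpha>]) + T (\<alpha> # f @ [G ! i]) * T (G[i := \<beta>])) = 0"
    if len: "Suc (Suc (length f)) = n" "length G = n" for \<alpha> \<beta> f G
  proof -
    have head: "T ((\<alpha> + \<beta>) # f @ [\<eta>]) = T (\<alpha> # f @ [\<eta>]) + T (\<beta> # f @ [\<eta>])" for \<eta>
      using multivector_update_add[OF T, of "\<alpha> # f @ [\<eta>]" 0 \<alpha> \<beta>] len by simp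
    have upd: "T (G[i := \<alpha> + \<beta>]) = T (G[i := \<alpha>]) + T (G[i := \<beta>])" if "i < n" for i
      by (rule multivector_update_add[OF T len(2) that])
    have "0 = (\<Sum>i<n. T ((\<alpha> + \<beta>) # f @ [G ! i]) * T (G[i := \<alpha> + \<beta>]))"
      using sq[OF len] by simp
    also have "\<dots> = (\<Sum>i<n. T (\<alpha> # f @ [G ! i]) * T (G[i := \<alpha>])) + (\<Sum>i<n. T (\<beta> # f @ [G ! i]) * T (G[i := \<beta>]))
        + (\<Sum>i<n. T (\<beta> # f @ [G ! i]) * T (G[i := \<alpha>]) + T (\<alpha> # f @ [G ! i]) * T (G[i := \<beta>]))"
      unfolding sum.distrib[symmetric]
      by (rule sum.cong) (simp_all add: head upd algebra_simps)
    finally show ?thesis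
      using sq[OF len] by simp
  qed
  have mixed_ends: "T (\<kappa> # f @ [a ! j]) = 0"
    if \<kappa>: "\<kappa> \<in> K" and j: "j < n" and f: "Suc (Suc (length f)) = n" for \<kappa> f j
  proof -
    have "T (a[i := a ! j]) = (if i = j then 1 else 0)" "T (a[i := \<kappa>]) = 0" if "i < n" for i
      using multivector_update_frame[OF T a(1) that j] a \<kappa> that by (auto simp: K_def)
    then have "(\<Sum>i<n. T (a ! j # f @ [a ! i]) * T (a[i := \<kappa>]) + T (\<kappa> # f @ [a ! i]) * T (a[i := a ! j])) =
        (\<Sum>i<n. if i = j then T (\<kappa> # f @ [a ! i]) else 0)"
      by (intro sum.cong) auto
    then show ?thesis
      using polarized[OF f a(1), of "a ! j" \<kappa>] j by simp
  qed
  have mixed: "T G = 0"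
    if G: "length G = n" "l < n" "l' < n" "l \<noteq> l'" "G ! l \<in> K" "G ! l' \<in> set a" for G l l'
  proof -
    obtain f where f: "Suc (Suc (length f)) = n" "mset G = mset (G ! l # f @ [G ! l'])"
      using mset_two_entries[of l G l'] G by metis
    obtain j where "j < n" "G ! l' = a ! j"
      using G(6) a(1) by (auto simp: in_set_conv_nth)
    then show ?thesis
      using mixed_ends[OF G(5) _ f(1)] multivector_permute[OF T f(2)] by simp
  qed
  have pure: "T G = 0" if G: "length G = n" "set G \<subseteq> K" for G
  proof -
    obtain \<kappa> \<kappa>s where G_eq: "G = \<kappa> # \<kappa>s"
      using G n by (cases G) auto
    obtain a0 a1 f where a_eq: "a = a0 # a1 # f"
      using a(1) n by (cases a; cases "tl a") auto
    have f: "Suc (Suc (length f)) = n" "f ! 0 \<in> set a" "f \<noteq> []"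
      using a(1) n a_eq by (auto simp: nth_append)
    \<comment> \<open>Replacing the first entry of \<open>G\<close> by \<open>a0\<close> makes every summand mixed, except the one that
      exchanges \<open>a0\<close> and \<open>\<kappa>\<close>; since \<open>n > 2\<close>, \<open>f\<close> still contains a member of the frame.\<close>
    let ?H = "a0 # \<kappa>s"
    have H: "length ?H = n" using G G_eq by simp
    have first: "T (\<kappa> # f @ [\<eta>]) = 0" for \<eta>
      by (rule mixed[of _ 0 1]) (use f G G_eq n in \<open>auto simp: nth_append\<close>)
    have second: "T (a1 # f @ [\<eta>]) = 0" if "\<eta> \<in> K" for \<eta>
      by (rule mixed[of _ "n - 1" 0]) (use f that a_eq n in \<open>auto simp: nth_append\<close>)
    have "(\<Sum>i<n. T (\<kappa> # f @ [?H ! i]) * T (?H[i := a1]) + T (a1 # f @ [?H ! i]) * T (?H[i := \<kappa>])) =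
        (\<Sum>i<n. if i = 0 then T (a1 # f @ [a0]) * T G else 0)"
    proof (rule sum.cong[OF refl])
      fix i assume "i \<in> {..<n}"
      then show "T (\<kappa> # f @ [?H ! i]) * T (?H[i := a1]) + T (a1 # f @ [?H ! i]) * T (?H[i := \<kappa>]) =
          (if i = 0 then T (a1 # f @ [a0]) * T G else 0)"
        using G G_eq by (cases i) (auto simp: first second dest!: nth_mem)
    qed
    then have "T (a1 # f @ [a0]) * T G = 0"
      using polarized[OF f(1) H, of \<kappa> a1] n by simp
    moreover have "\<bar>T (a1 # f @ [a0])\<bar> = 1"
      using multivector_permute[OF T, of "a1 # f @ [a0]" a] a(2) by (simp add: a_eq)
    ultimately show ?thesis by auto
  qed
  \<comment> \<open>It suffices to test on frame and kernel covectors, which span everything.\<close>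
  have span: "span (set a \<union> K) = UNIV"
  proof -
    have "\<xi> \<in> span (set a \<union> K)" for \<xi>
    proof -
      define \<sigma> where "\<sigma> = (\<Sum>i<n. T (a[i := \<xi>]) *\<^sub>R a ! i)"
      have "\<xi> - \<sigma> \<in> K"
        using frame_projection_in_kernel[OF T a] by (simp add: K_def \<sigma>_def)
      moreover have "\<sigma> \<in> span (set a \<union> K)"
        unfolding \<sigma>_def using a(1) by (intro span_sum span_scale span_base) auto
      ultimately have "(\<xi> - \<sigma>) + \<sigma> \<in> span (set a \<union> K)"
        by (intro span_add) (auto intro: span_base)
      then show ?thesis by simp
    qed
    then show ?thesis by auto
  qed
  show ?thesis
  proof (rule multivector_zero_on_span[OF T, where A = "\<lambda>i. if i = l then {\<kappa>} else set a \<union> K"])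
    fix H assume H: "length H = n" "\<And>i. i < n \<Longrightarrow> H ! i \<in> (if i = l then {\<kappa>} else set a \<union> K)"
    have Hl: "H ! l \<in> K"
      using H(2)[OF G(2)] \<kappa> by (simp add: K_def)
    show "T H = 0"
    proof (cases "set H \<subseteq> K")
      case True
      then show ?thesis by (rule pure[OF H(1)])
    next
      case False
      then obtain l' where l': "l' < n" "H ! l' \<notin> K"
        using H(1) by (metis in_set_conv_nth subsetI)
      then have "l' \<noteq> l" "H ! l' \<in> set a"
        using Hl H(2)[of l'] by (auto split: if_splits)
      then show ?thesis
        using mixed[OF H(1) G(2) l'(1)] Hl by auto
    qed
  next
    fix i assume "i < n"
    then show "G[l := \<kappa>] ! i \<in> span (if i = l then {\<kappa>} else set a \<union> K)"
      using G by (auto simp: span intro: span_base)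
  qed (use G in simp)
qed

section \<open>Linear families of decomposable tensors\<close>

text \<open>The classical fact about linear spaces of matrices of rank at most one: either all rows are
  multiples of one row, or all columns are multiples of one column. After normalizing at \<open>W q0\<close>, each
  \<open>W r\<close> is the sum of a multiple of the fixed column plus a multiple of the fixed row, and one of the
  two correction factors \<open>x\<close>, \<open>z\<close> vanishes. Either condition is linear in \<open>r\<close>, and a vector space is
  not the union of two proper subspaces.\<close>

lemma rank_one_family_dichotomy:
  fixes W :: "'v::real_vector \<Rightarrow> 'i \<Rightarrow> 'k \<Rightarrow> real"
  assumes lin: "\<And>i k. linear (\<lambda>q. W q i k)"
    and rank: "\<And>q i j k k'. i \<in> I \<Longrightarrow> j \<in> I \<Longrightarrow> k \<in> K \<Longrightarrow> k' \<in> K \<Longrightarrow>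
      W q i k * W q j k' = W q j k * W q i k'"
    and base: "i0 \<in> I" "k0 \<in> K" "W q0 i0 k0 = 1"
  shows "(\<forall>q. \<forall>i\<in>I. \<forall>k\<in>K. W q i k = W q i k0 * W q0 i0 k) \<or>
    (\<forall>q. \<forall>i\<in>I. \<forall>k\<in>K. W q i k = W q0 i k0 * W q i0 k)"
proof -
  define x where "x r i = W r i k0 - W q0 i k0 * W r i0 k0" for r i
  define z where "z r k = W r i0 k - W r i0 k0 * W q0 i0 k" for r k
  have Wadd: "W (q + r) i k = W q i k + W r i k" for q r i k
    by (rule linear_add[OF lin])
  have W0: "W q0 i k = W q0 i k0 * W q0 i0 k" if "i \<in> I" "k \<in> K" for i k
    using rank[of i0 i k0 k q0] base that by simp
  have form: "W r i k = W q0 i k0 * W r i0 k + x r i * W q0 i0 k" if ik: "i \<in> I" "k \<in> K" for r i k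
  proof -
    have "W (q0 + r) i0 k0 * W (q0 + r) i k = W (q0 + r) i k0 * W (q0 + r) i0 k"
      using rank base ik by blast
    moreover have "W r i0 k0 * W r i k = W r i k0 * W r i0 k"
      using rank base ik by blast
    ultimately show ?thesis
      using base W0[OF ik] by (simp add: Wadd x_def algebra_simps)
  qed
  have prod: "x r i * z r k = 0" if ik: "i \<in> I" "k \<in> K" for r i k
  proof -
    have "W r i0 k0 * W r i k = W r i k0 * W r i0 k"
      using rank base ik by blast
    then show ?thesis
      unfolding form[OF ik] by (simp add: x_def z_def algebra_simps)
  qed
  have xadd: "x (q + r) i = x q i + x r i" and zadd: "z (q + r) k = z q k + z r k" for q r i k
    by (simp_all add: x_def z_def Wadd algebra_simps)
  show ?thesis
  proof (rule ccontr)
    assume "\<not> ?thesis"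
    then obtain r i k r' i' k' where r: "i \<in> I" "k \<in> K" "W r i k \<noteq> W r i k0 * W q0 i0 k"
      and r': "i' \<in> I" "k' \<in> K" "W r' i' k' \<noteq> W q0 i' k0 * W r' i0 k'"
      by blast
    have zr: "z r k \<noteq> 0"
      using r by (auto simp: form[OF r(1,2)] x_def z_def algebra_simps)
    have xr': "x r' i' \<noteq> 0"
      using r' by (auto simp: form[OF r'(1,2)])
    have "x r i' = 0" "z r' k = 0"
      using prod[OF r'(1) r(2), of r] prod[OF r'(1) r(2), of r'] zr xr' by auto
    then show False
      using prod[OF r'(1) r(2), of "r + r'"] zr xr' by (simp add: xadd zadd)
  qed
qed

locale linear_nambu = linear_multivector +
  assumes order: "n > 2"
    and nambu: "nambu_poisson n \<Lambda>"
begin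

lemmas update_sum = multivector_update_sum[OF multivector]
lemmas update_diff = multivector_update_diff[OF multivector]
lemmas update_add = multivector_update_add[OF multivector]
lemmas update_scale = multivector_update_scale[OF multivector]
lemmas update_frame = multivector_update_frame[OF multivector]

lemma at_add: "\<Lambda> (p + q) \<xi>s = \<Lambda> p \<xi>s + \<Lambda> q \<xi>s"
  by (rule linear_add[OF linear])

lemma at_diff: "\<Lambda> (p - q) \<xi>s = \<Lambda> p \<xi>s - \<Lambda> q \<xi>s"
  by (rule linear_diff[OF linear])

lemma at_scale: "\<Lambda> (c *\<^sub>R p) \<xi>s = c * \<Lambda> p \<xi>s"
  using linear_cmul[OF linear, of c p \<xi>s] by simp

lemma filippov:
  "Suc (length F) = n \<Longrightarrow> length G = n \<Longrightarrow>
    \<Lambda> p (F @ [bracket \<Lambda> G]) = (\<Sum>i<n. \<Lambda> p (G[i := bracket \<Lambda> (F @ [G ! i])]))"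
  by (rule filippov_covectors[OF nambu])

lemma kernel:
  assumes "length a = n" "\<Lambda> p a = 1" "\<And>i. i < n \<Longrightarrow> \<Lambda> p (a[i := \<kappa>]) = 0"
    and "length G = n" "l < n"
  shows "\<Lambda> p (G[l := \<kappa>]) = 0"
  using kernel_of_nonzero_value[OF order multivector square_identity[OF nambu]] assms by blast

end

text \<open>A point \<open>p\<close> where the tensor does not vanish, with covectors \<open>a\<close> on which it takes the value 1; \<open>K\<close>
  is the annihilator of the support of \<open>\<Lambda>\<close> at \<open>p\<close>. The values \<open>\<Lambda> q (a[i := \<kappa>])\<close> with
  \<open>\<kappa> \<in> K\<close> measure how far the support at \<open>q\<close> leaves the one at \<open>p\<close>.\<close>

locale framed_nambu = linear_nambu +
  fixes p a
  assumes frame: "length a = n" "\<Lambda> p a = 1"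
begin

definition K where "K = {\<kappa>. \<forall>i<n. \<Lambda> p (a[i := \<kappa>]) = 0}"

lemma K_kernel: "\<kappa> \<in> K \<Longrightarrow> length G = n \<Longrightarrow> l < n \<Longrightarrow> \<Lambda> p (G[l := \<kappa>]) = 0"
  by (rule kernel[OF frame]) (auto simp: K_def)

text \<open>Perturbation of \<open>p\<close> to \<open>p + s q\<close>: the kernel covector \<open>\<kappa>\<close> has to be corrected to
  \<open>\<kappa> - s \<omega>\<close>, and \<open>\<Lambda>\<close> at \<open>p + s q\<close> vanishes on the corrected covector for every \<open>s\<close>. The two
  equations are the coefficients of \<open>s\<close> and \<open>s\<^sup>2\<close>.\<close>

lemma kernel_comparison:
  assumes \<kappa>: "\<kappa> \<in> K" and q: "\<Lambda> q a = 0" and G: "length G = n" "l < n"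
  shows "\<Lambda> q (G[l := \<kappa>]) = (\<Sum>i<n. \<Lambda> q (a[i := \<kappa>]) * \<Lambda> p (G[l := a ! i]))"
    and "(\<Sum>i<n. \<Lambda> q (a[i := \<kappa>]) * \<Lambda> q (G[l := a ! i])) = 0"
proof -
  define \<omega> where "\<omega> = (\<Sum>i<n. \<Lambda> q (a[i := \<kappa>]) *\<^sub>R a ! i)"
  have \<omega>: "\<Lambda> r (G[l := \<omega>]) = (\<Sum>i<n. \<Lambda> q (a[i := \<kappa>]) * \<Lambda> r (G[l := a ! i]))"
    if "length G = n" "l < n" for r G l
    unfolding \<omega>_def by (rule update_sum[OF that])
  have key: "s * (\<Lambda> q (G[l := \<kappa>]) - \<Lambda> p (G[l := \<omega>])) - s\<^sup>2 * \<Lambda> q (G[l := \<omega>]) = 0" for s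
  proof -
    have "\<Lambda> (p + s *\<^sub>R q) (G[l := \<kappa> - s *\<^sub>R \<omega>]) = 0"
    proof (rule kernel[OF frame(1) _ _ G])
      show "\<Lambda> (p + s *\<^sub>R q) a = 1"
        using frame q by (simp add: at_add at_scale)
      show "\<Lambda> (p + s *\<^sub>R q) (a[i := \<kappa> - s *\<^sub>R \<omega>]) = 0" if i: "i < n" for i
      proof -
        have "\<Lambda> p (a[i := \<omega>]) = (\<Sum>j<n. if i = j then \<Lambda> q (a[j := \<kappa>]) else 0)"
          unfolding \<omega>[OF frame(1) i] by (rule sum.cong) (auto simp: update_frame[OF frame(1) i] frame)
        then have "\<Lambda> p (a[i := \<omega>]) = \<Lambda> q (a[i := \<kappa>])"
          using i by simp
        moreover have "\<Lambda> q (a[i := \<omega>]) = 0"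
          unfolding \<omega>[OF frame(1) i] by (rule sum.neutral) (auto simp: update_frame[OF frame(1) i] q)
        moreover have "\<Lambda> p (a[i := \<kappa>]) = 0"
          using \<kappa> i by (simp add: K_def)
        ultimately show ?thesis
          by (simp add: at_add at_scale update_diff[OF frame(1) i] update_scale[OF frame(1) i])
      qed
    qed
    then show ?thesis
      by (simp add: at_add at_scale update_diff[OF G] update_scale[OF G] K_kernel[OF \<kappa> G]
          algebra_simps power2_eq_square)
  qed
  from key[of 1] key[of "-1"]
  show "\<Lambda> q (G[l := \<kappa>]) = (\<Sum>i<n. \<Lambda> q (a[i := \<kappa>]) * \<Lambda> p (G[l := a ! i]))"
    and "(\<Sum>i<n. \<Lambda> q (a[i := \<kappa>]) * \<Lambda> q (G[l := a ! i])) = 0"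
    unfolding \<omega>[OF G, symmetric] by simp_all
qed

text \<open>A multiple of \<open>p\<close> can be subtracted from \<open>q\<close> without affecting either side.\<close>

lemma kernel_slot:
  assumes \<kappa>: "\<kappa> \<in> K" and G: "length G = n" "l < n"
  shows "\<Lambda> q (G[l := \<kappa>]) = (\<Sum>i<n. \<Lambda> q (a[i := \<kappa>]) * \<Lambda> p (G[l := a ! i]))"
proof -
  have z: "\<Lambda> p (a[i := \<kappa>]) = 0" if "i < n" for i
    using \<kappa> that by (simp add: K_def)
  have "\<Lambda> (q - \<Lambda> q a *\<^sub>R p) a = 0"
    by (simp add: at_diff at_scale frame)
  from kernel_comparison(1)[OF \<kappa> this G] show ?thesis
    by (simp add: at_diff at_scale K_kernel[OF \<kappa> G] z)
qed

text \<open>Two supports of dimension \<open>n\<close> in a linear family of decomposable tensors meet in dimension at least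
  \<open>n - 1\<close>; in the present terms this says that the matrix \<open>\<Lambda> q (a[i := \<kappa>])\<close> has rank at most
  one. It is the second equation of \<open>kernel_comparison\<close> on lists with one kernel entry.\<close>

lemma kernel_rank_one:
  assumes \<kappa>: "\<kappa> \<in> K" "\<kappa>' \<in> K" and ij: "i < n" "j < n"
  shows "\<Lambda> q (a[i := \<kappa>]) * \<Lambda> q (a[j := \<kappa>']) = \<Lambda> q (a[j := \<kappa>]) * \<Lambda> q (a[i := \<kappa>'])"
proof (cases "i = j")
  case False
  define q' where "q' = q - \<Lambda> q a *\<^sub>R p"
  have q'a: "\<Lambda> q' a = 0"
    by (simp add: q'_def at_diff at_scale frame)
  have q': "\<Lambda> q' (a[m := \<theta>]) = \<Lambda> q (a[m := \<theta>])" if "m < n" "\<theta> \<in> K" for m \<theta>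
    using that by (simp add: q'_def at_diff at_scale K_def)
  let ?G = "a[j := \<kappa>']"
  have G: "length ?G = n" using frame by simp
  have val: "\<Lambda> q' (?G[i := a ! m]) =
      (if m = i then \<Lambda> q (a[j := \<kappa>']) else if m = j then - \<Lambda> q (a[i := \<kappa>']) else 0)"
    if m: "m < n" for m
  proof -
    consider "m = i" | "m = j" | "m \<noteq> i" "m \<noteq> j" by blast
    then show ?thesis
    proof cases
      case 1
      have "?G[i := a ! i] = ?G"
        using False by (metis list_update_id list_update_swap)
      then show ?thesis using 1 q'[OF ij(2) \<kappa>(2)] by simp
    next
      case 2
      have "\<Lambda> q' (a[j := \<kappa>', i := a ! j]) = - \<Lambda> q' (a[j := a ! j, i := \<kappa>'])"
        by (rule multivector_swap[OF multivector frame(1)]) (use ij False in auto)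
      then show ?thesis using 2 False q'[OF ij(1) \<kappa>(2)] by simp
    next
      case 3
      have "\<Lambda> q' (?G[i := a ! m]) = 0"
        by (rule multivector_repeat[OF multivector, of i _ m]) (use 3 m ij frame in auto)
      then show ?thesis using 3 by simp
    qed
  qed
  have "0 = (\<Sum>m<n. \<Lambda> q' (a[m := \<kappa>]) * \<Lambda> q' (?G[i := a ! m]))"
    using kernel_comparison(2)[OF \<kappa>(1) q'a G ij(1)] by simp
  also have "\<dots> = (\<Sum>m<n. (if m = i then \<Lambda> q (a[i := \<kappa>]) * \<Lambda> q (a[j := \<kappa>']) else 0) +
      (if m = j then - \<Lambda> q (a[j := \<kappa>]) * \<Lambda> q (a[i := \<kappa>']) else 0))"
    using \<kappa> False by (intro sum.cong) (auto simp: val q')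
  also have "\<dots> = \<Lambda> q (a[i := \<kappa>]) * \<Lambda> q (a[j := \<kappa>']) - \<Lambda> q (a[j := \<kappa>]) * \<Lambda> q (a[i := \<kappa>'])"
    using ij by (simp add: sum.distrib)
  finally show ?thesis by simp
qed simp

lemma frame_linear: "i < n \<Longrightarrow> linear (\<lambda>\<xi>. \<Lambda> q (a[i := \<xi>]))"
  by (rule multivector_linear[OF multivector frame(1)])

lemma frame_projection: "\<xi> - (\<Sum>i<n. \<Lambda> p (a[i := \<xi>]) *\<^sub>R a ! i) \<in> K"
  using frame_projection_in_kernel[OF multivector frame] by (simp add: K_def)

end

section \<open>One-dimensional families\<close>

lemma multivector_eq_permuted:
  assumes "multivector n T" "multivector n S" "mset js = mset is" "T (map X js) = S (map X js)"
  shows "T (map X is) = S (map X is)"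
  using multivector_permute[OF multivector_diff[OF assms(1,2)], of "map X is" "map X js"] assms(3,4)
  by simp

lemma mset_eq_distinct:
  assumes "distinct is" "distinct js" "set is = set js"
  shows "mset is = mset js"
  using assms set_eq_iff_mset_eq_distinct by blast

locale coordinate_nambu = framed_nambu n \<Lambda> p a
  for n and \<Lambda> :: "real ^ 'm \<Rightarrow> ((real ^ 'm) \<Rightarrow>\<^sub>L real) list \<Rightarrow> real" and p a
begin

lemma at_expansion:
  assumes "linear_coordinates (\<lambda>i. blinfun_apply (X i)) e" "span (X ` {1..CARD('m)}) = UNIV"
  shows "\<Lambda> v \<xi>s = (\<Sum>i=1..CARD('m). \<Lambda> (e i) \<xi>s * blinfun_apply (X i) v)"
  using arg_cong[OF covector_expansion[OF assms, of "bracket \<Lambda> \<xi>s"], of "\<lambda>\<xi>. blinfun_apply \<xi> v"]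
  by (simp add: bracket_apply blinfun.sum_left blinfun.scaleR_left)

text \<open>If no support leaves the one at \<open>p\<close>, then all tensors are multiples of the one at \<open>p\<close>.\<close>

lemma form_A:
  assumes W: "\<And>q i \<kappa>. i < n \<Longrightarrow> \<kappa> \<in> K \<Longrightarrow> \<Lambda> q (a[i := \<kappa>]) = 0"
  shows "\<exists>(x :: nat \<Rightarrow> real ^ 'm \<Rightarrow> real) e \<phi>. linear_coordinates x e \<and> linear \<phi> \<and>
    \<Lambda> = (\<lambda>v \<xi>s. \<phi> v * wedge (map e [1..<n+1]) \<xi>s)"
proof -
  obtain X e where coords: "linear_coordinates (\<lambda>i. blinfun_apply (X i)) e"
    and span: "span (X ` {1..CARD('m)}) = UNIV" and nm: "length a \<le> CARD('m)"
    and Xa: "\<And>i. i < length a \<Longrightarrow> X (Suc i) = a ! i"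
    and XK: "\<And>i j. i < length a \<Longrightarrow> length a < j \<Longrightarrow> j \<le> CARD('m) \<Longrightarrow> \<Lambda> p (a[i := X j]) = 0"
  proof (rule adapted_coordinates[of a "\<lambda>i \<xi>. \<Lambda> p (a[i := \<xi>])"])
    show "linear (\<lambda>\<xi>. \<Lambda> p (a[i := \<xi>]))" if "i < length a" for i
      using frame_linear that frame by simp
    show "\<Lambda> p (a[i := a ! j]) = (if i = j then 1 else 0)" if "i < length a" "j < length a" for i j
      using update_frame[OF frame(1), of i j] that frame by simp
  qed blast
  have dual: "blinfun_apply (X i) (e j) = (if i = j then 1 else 0)"
    if "i \<in> {1..CARD('m)}" "j \<in> {1..CARD('m)}" for i j
    using coords that by (simp add: linear_coordinates_def)
  have Xmap: "map X [1..<n+1] = a"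
    by (rule nth_equalityI) (use frame Xa in \<open>auto simp: nth_append simp del: upt_Suc\<close>)
  let ?w = "wedge (map e [1..<n+1])"
  have w: "multivector n ?w"
    using multivector_wedge[of "map e [1..<n+1]"] by (simp del: upt_Suc)
  have "\<Lambda> v = (\<lambda>\<xi>s. \<Lambda> v a * ?w \<xi>s)" for v
  proof (rule multivector_eqI[OF multivector multivector_scale[OF w] span])
    fix js assume js: "length js = n" "distinct js" "set js \<subseteq> {1..CARD('m)}"
    show "\<Lambda> v (map X js) = \<Lambda> v a * ?w (map X js)"
    proof (cases "set js \<subseteq> {1..n}")
      case True
      then have "set js = {1..n}"
        using js distinct_card by (intro card_subset_eq) auto
      then have "mset [1..<n+1] = mset js"
        using js by (intro mset_eq_distinct)
          (simp_all add: atLeastLessThanSuc_atLeastAtMost del: upt_Suc)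
      moreover have "?w (map X [1..<n+1]) = 1"
        by (subst wedge_unitriangular) (use frame nm order dual in \<open>auto simp del: upt_Suc simp: last_map\<close>)
      then have "\<Lambda> v (map X [1..<n+1]) = \<Lambda> v a * ?w (map X [1..<n+1])"
        unfolding Xmap by simp
      ultimately show ?thesis
        by (rule multivector_eq_permuted[OF multivector multivector_scale[OF w]])
    next
      case False
      then obtain l where l: "l < n" "js ! l > n" "js ! l \<le> CARD('m)"
        using js by (auto simp: in_set_conv_nth subset_iff not_le)
      have "X (js ! l) \<in> K"
        using XK l frame by (auto simp: K_def)
      then have "\<Lambda> v ((map X js)[l := X (js ! l)]) = 0"
        using kernel_slot[of "X (js ! l)" "map X js" l v] W l js by simp
      moreover have "(map X js)[l := X (js ! l)] = map X js"
        using l js by (metis length_map list_update_id nth_map)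
      moreover have "?w (map X js) = 0"
        by (rule wedge_zero_row[of l]) (use l js dual in auto)
      ultimately show ?thesis by simp
    qed
  qed
  then have "\<Lambda> = (\<lambda>v \<xi>s. \<Lambda> v a * ?w \<xi>s)"
    by (rule ext)
  then show ?thesis
    using coords linear by blast
qed

end

text \<open>A second point \<open>q0\<close> whose tensor leaves the support at \<open>p\<close>, in the direction dual to \<open>k0\<close> and
  through the last slot of the frame.\<close>

locale nambu_pencil = coordinate_nambu n \<Lambda> p a
  for n and \<Lambda> :: "real ^ 'm \<Rightarrow> ((real ^ 'm) \<Rightarrow>\<^sub>L real) list \<Rightarrow> real" and p a +
  fixes q0 k0
  assumes q0: "\<Lambda> q0 a = 0" "\<Lambda> q0 (a[n - 1 := k0]) = 1" and k0: "k0 \<in> K"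
begin

lemma frame_last: "a[n - 1 := \<xi>] = butlast a @ [\<xi>]"
proof -
  have "a \<noteq> []"
    using frame order by auto
  from arg_cong[OF append_butlast_last_id[OF this, symmetric], of "\<lambda>xs. xs[n - 1 := \<xi>]"]
  show ?thesis
    using frame list_update_length[of "butlast a" "last a" "[]" \<xi>] by simp
qed

section \<open>Families with a common (n-1)-dimensional support\<close>

text \<open>All matrices \<open>\<Lambda> q (a[i := \<kappa>])\<close> share the column \<open>c\<close>. Then \<open>\<Lambda>\<close> vanishes as soon as two
  arguments lie in \<open>L\<close>, the span of \<open>K\<close> and \<open>\<gamma> = \<Sum> c\<^sub>i a\<^sub>i\<close>: every tensor is the wedge of the fixed
  vectors \<open>\<partial>\<^sub>1, \<dots>, \<partial>\<^bsub>n-1\<^esub>\<close>, which span the annihilator of \<open>L\<close>, and of a vector that depends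
  linearly on the point. It remains to see that this vector field does not depend on
  \<open>x\<^sub>1, \<dots>, x\<^bsub>n-1\<^esub>\<close> modulo \<open>\<partial>\<^sub>1, \<dots>, \<partial>\<^bsub>n-1\<^esub>\<close>. This is the integrability contained in the Filippov
  identity for linear functions: it makes the components of the derivative along \<open>\<partial>\<^sub>k\<close>
  proportional to those of the field itself, which is impossible unless they vanish, because
  the field takes two independent values at \<open>p\<close> and \<open>q0\<close>.\<close>

lemma form_C:
  assumes family: "\<forall>q. \<forall>i\<in>{..<n}. \<forall>\<kappa>\<in>K.
      \<Lambda> q (a[i := \<kappa>]) = \<Lambda> q0 (a[i := k0]) * \<Lambda> q (a[n - 1 := \<kappa>])"
  shows "\<exists>(x :: nat \<Rightarrow> real ^ 'm \<Rightarrow> real) e b. linear_coordinates x e \<and>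
    \<Lambda> = (\<lambda>v. wedge (map e [1..<n] @
      [\<Sum>i=n..CARD('m). \<Sum>j=n..CARD('m). (b i j * x i v) *\<^sub>R e j]))"
proof -
  have common: "\<Lambda> q (a[i := \<kappa>]) = \<Lambda> q0 (a[i := k0]) * \<Lambda> q (a[n - 1 := \<kappa>])"
    if "i < n" "\<kappa> \<in> K" for q i \<kappa>
    by (rule family[rule_format]) (use that in simp_all)
  define c where "c i = \<Lambda> q0 (a[i := k0])" for i
  define \<gamma> where "\<gamma> = (\<Sum>i<n. c i *\<^sub>R a ! i)"
  have last: "n - 1 < n" and clast: "c (n - 1) = 1"
    using order q0 by (simp_all add: c_def)
  have slot: "\<Lambda> q (G[l := \<kappa>]) = \<Lambda> q (a[n - 1 := \<kappa>]) * \<Lambda> p (G[l := \<gamma>])"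
    if "\<kappa> \<in> K" "length G = n" "l < n" for q G l \<kappa>
  proof -
    have "\<Lambda> q (G[l := \<kappa>]) = (\<Sum>i<n. (c i * \<Lambda> q (a[n - 1 := \<kappa>])) * \<Lambda> p (G[l := a ! i]))"
      unfolding kernel_slot[OF that] c_def by (rule sum.cong[OF refl], subst common[OF _ that(1)]) auto
    then show ?thesis
      unfolding \<gamma>_def update_sum[OF that(2,3)] by (simp add: sum_distrib_left mult_ac)
  qed
  define L where "L = {\<xi>. \<forall>i<n. \<Lambda> p (a[i := \<xi>]) = c i * \<Lambda> p (a[n - 1 := \<xi>])}"
  have p\<gamma>: "\<Lambda> p (a[i := \<gamma>]) = c i" if i: "i < n" for i
  proof -
    have "\<Lambda> p (a[i := \<gamma>]) = (\<Sum>j<n. if i = j then c j else 0)"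
      unfolding \<gamma>_def update_sum[OF frame(1) i]
      by (rule sum.cong) (auto simp: update_frame[OF frame(1) i] frame)
    then show ?thesis using i by simp
  qed
  have \<gamma>L: "\<gamma> \<in> L" and KL: "K \<subseteq> L"
    using last clast by (simp_all add: L_def p\<gamma> K_def subset_iff)
  have L_decomp: "\<exists>\<beta>. \<exists>\<kappa>\<in>K. \<xi> = \<beta> *\<^sub>R \<gamma> + \<kappa>" if "\<xi> \<in> L" for \<xi>
  proof -
    let ?\<beta> = "\<Lambda> p (a[n - 1 := \<xi>])"
    have "(\<Sum>i<n. \<Lambda> p (a[i := \<xi>]) *\<^sub>R a ! i) = (\<Sum>i<n. (c i * ?\<beta>) *\<^sub>R a ! i)"
    proof (rule sum.cong[OF refl])
      fix i assume "i \<in> {..<n}"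
      then have "\<Lambda> p (a[i := \<xi>]) = c i * ?\<beta>"
        using that unfolding L_def by blast
      then show "\<Lambda> p (a[i := \<xi>]) *\<^sub>R a ! i = (c i * ?\<beta>) *\<^sub>R a ! i"
        by (rule arg_cong)
    qed
    then have "(\<Sum>i<n. \<Lambda> p (a[i := \<xi>]) *\<^sub>R a ! i) = ?\<beta> *\<^sub>R \<gamma>"
      by (simp add: \<gamma>_def scaleR_sum_right mult.commute)
    then have "\<xi> - ?\<beta> *\<^sub>R \<gamma> \<in> K"
      using frame_projection[of \<xi>] by simp
    moreover have "\<xi> = ?\<beta> *\<^sub>R \<gamma> + (\<xi> - ?\<beta> *\<^sub>R \<gamma>)" by simp
    ultimately show ?thesis by blast
  qed
  have two: "\<Lambda> q H = 0" if H: "length H = n" "l < n" "l' < n" "l \<noteq> l'" "H ! l \<in> L" "H ! l' \<in> L" for q H l l'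
  proof -
    have \<gamma>\<gamma>: "\<Lambda> q (H[l := \<gamma>, l' := \<gamma>]) = 0" for q
      by (rule multivector_repeat[OF multivector, of l _ l']) (use H in auto)
    have \<gamma>\<kappa>: "\<Lambda> q (H[l := \<gamma>, l' := \<kappa>]) = 0" if "\<kappa> \<in> K" for q \<kappa>
      using slot[OF that, of "H[l := \<gamma>]" l' q] H \<gamma>\<gamma> by simp
    have \<kappa>\<gamma>: "\<Lambda> q (H[l := \<kappa>, l' := \<gamma>]) = 0" if "\<kappa> \<in> K" for q \<kappa>
      using slot[OF that, of "H[l' := \<gamma>]" l q] H \<gamma>\<gamma> by (simp add: list_update_swap)
    have \<kappa>\<kappa>: "\<Lambda> q (H[l := \<kappa>, l' := \<kappa>']) = 0" if "\<kappa> \<in> K" "\<kappa>' \<in> K" for q \<kappa> \<kappa>'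
      using slot[OF that(2), of "H[l := \<kappa>]" l' q] H \<kappa>\<gamma>[OF that(1)] by simp
    obtain \<beta> \<kappa> \<beta>' \<kappa>' where \<kappa>: "\<kappa> \<in> K" "H ! l = \<beta> *\<^sub>R \<gamma> + \<kappa>" and \<kappa>': "\<kappa>' \<in> K" "H ! l' = \<beta>' *\<^sub>R \<gamma> + \<kappa>'"
      using L_decomp H by metis
    have lin': "\<Lambda> q (H[l := \<theta>, l' := \<beta>' *\<^sub>R \<gamma> + \<kappa>']) = \<beta>' * \<Lambda> q (H[l := \<theta>, l' := \<gamma>]) + \<Lambda> q (H[l := \<theta>, l' := \<kappa>'])" for \<theta>
      using update_add[of "H[l := \<theta>]" l'] update_scale[of "H[l := \<theta>]" l'] H by simp
    have lin: "\<Lambda> q (H[l := \<beta> *\<^sub>R \<gamma> + \<kappa>, l' := \<theta>]) = \<beta> * \<Lambda> q (H[l := \<gamma>, l' := \<theta>]) + \<Lambda> q (H[l := \<kappa>, l' := \<theta>])" for \<theta>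
      using update_add[of "H[l' := \<theta>]" l] update_scale[of "H[l' := \<theta>]" l] H by (simp add: list_update_swap)
    have "H[l := \<beta> *\<^sub>R \<gamma> + \<kappa>, l' := \<beta>' *\<^sub>R \<gamma> + \<kappa>'] = H"
      unfolding \<kappa>(2)[symmetric] \<kappa>'(2)[symmetric] by simp
    then have "\<Lambda> q H = \<Lambda> q (H[l := \<beta> *\<^sub>R \<gamma> + \<kappa>, l' := \<beta>' *\<^sub>R \<gamma> + \<kappa>'])"
      by (simp only:)
    then show ?thesis
      unfolding lin lin' by (simp add: \<gamma>\<gamma> \<gamma>\<kappa> \<kappa>\<gamma> \<kappa>\<kappa> \<kappa> \<kappa>')
  qed
  let ?d = "\<lambda>i \<xi>. \<Lambda> p (a[i := \<xi>]) - c i * \<Lambda> p (a[n - 1 := \<xi>])"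
  have lenb: "length (butlast a) = n - 1"
    using frame by simp
  obtain X e where coords: "linear_coordinates (\<lambda>i. blinfun_apply (X i)) e"
    and span: "span (X ` {1..CARD('m)}) = UNIV" and nm: "length (butlast a) \<le> CARD('m)"
    and Xa: "\<And>i. i < length (butlast a) \<Longrightarrow> X (Suc i) = butlast a ! i"
    and XL: "\<And>i j. i < length (butlast a) \<Longrightarrow> length (butlast a) < j \<Longrightarrow> j \<le> CARD('m) \<Longrightarrow> ?d i (X j) = 0"
  proof (rule adapted_coordinates[of "butlast a" ?d])
    show "linear (?d i)" if "i < length (butlast a)" for i
      using linear_compose_sub[OF frame_linear[of i p] linear_compose_scale_right[OF frame_linear[of "n - 1" p], of "c i"]]
        that lenb last by simp
    show "?d i (butlast a ! j) = (if i = j then 1 else 0)"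
      if "i < length (butlast a)" "j < length (butlast a)" for i j
      using update_frame[OF frame(1), of i j] update_frame[OF frame(1), of "n - 1" j] that frame last
      by (simp add: nth_butlast)
  qed blast
  have X_frame: "X (Suc i) = a ! i" if "i < n - 1" for i
    using Xa that lenb by (simp add: nth_butlast)
  have X_L: "X j \<in> L" if "n \<le> j" "j \<le> CARD('m)" for j
  proof -
    have "\<Lambda> p (a[i := X j]) = c i * \<Lambda> p (a[n - 1 := X j])" if "i < n" for i
    proof (cases "i = n - 1")
      case False
      then show ?thesis
        using XL[of i j] lenb \<open>i < n\<close> \<open>n \<le> j\<close> \<open>j \<le> CARD('m)\<close> by simp
    qed (use clast in simp)
    then show ?thesis unfolding L_def by blast
  qed
  have dual: "blinfun_apply (X i) (e j) = (if i = j then 1 else 0)"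
    if "i \<in> {1..CARD('m)}" "j \<in> {1..CARD('m)}" for i j
    using coords that by (simp add: linear_coordinates_def)
  \<comment> \<open>The field is invariant along the fixed directions; \<open>\<rho>\<close> runs through the covectors that see it.\<close>
  have invariance: "\<Lambda> (e (Suc k)) (a[n - 1 := \<rho>]) = 0" if k: "k < n - 1" and \<rho>: "\<rho> \<in> L" for k \<rho>
  proof -
    define f where "f = take k a @ drop (Suc k) (butlast a)"
    define u where "u = e (Suc k)"
    have lenf: "Suc (Suc (length f)) = n"
      using k frame by (simp add: f_def)
    have msetf: "mset (a ! k # \<rho> # f) = mset (a[n - 1 := \<rho>])" for \<rho>
    proof -
      have "butlast a = take k (butlast a) @ butlast a ! k # drop (Suc k) (butlast a)"
        using k lenb by (intro id_take_nth_drop) simp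
      then have "butlast a = take k a @ a ! k # drop (Suc k) (butlast a)"
        using k frame by (simp add: nth_butlast take_butlast)
      then have "mset (butlast a) = add_mset (a ! k) (mset f)"
        by (metis f_def mset_append mset.simps(2) union_mset_add_mset_right)
      then show ?thesis unfolding frame_last by simp
    qed
    have in_f: "a ! i \<in> set f" if "i < n - 1" "i \<noteq> k" for i
    proof (cases "i < k")
      case True
      then show ?thesis
        using nth_mem[of i "take k a"] that frame by (simp add: f_def)
    next
      case False
      then show ?thesis
        using nth_mem[of "i - Suc k" "drop (Suc k) (butlast a)"] that frame
        by (simp add: f_def nth_butlast)
    qed
    have repeat: "\<Lambda> v (\<xi> # \<rho> # f) = 0" if "\<xi> \<in> set f" for v \<xi> \<rho>
      by (rule multivector_not_distinct[OF multivector]) (use that in auto)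
    have expand: "\<Lambda> v (\<xi> # \<rho> # f) = blinfun_apply \<xi> u * \<Lambda> v (a ! k # \<rho> # f)"
      if "\<rho> \<in> L" for v \<xi> \<rho>
    proof -
      have len: "length (\<xi> # \<rho> # f) = n" "0 < n"
        using lenf by simp_all
      have "\<Lambda> v ((\<xi> # \<rho> # f)[0 := \<xi>]) =
          (\<Sum>j=1..CARD('m). blinfun_apply \<xi> (e j) * \<Lambda> v ((\<xi> # \<rho> # f)[0 := X j]))"
        by (subst covector_expansion[OF coords span, of \<xi>]) (rule update_sum[OF len])
      also have "\<dots> = (\<Sum>j=1..CARD('m). if j = Suc k then blinfun_apply \<xi> u * \<Lambda> v (a ! k # \<rho> # f) else 0)"
      proof (rule sum.cong[OF refl])
        fix j assume j: "j \<in> {1..CARD('m)}"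
        show "blinfun_apply \<xi> (e j) * \<Lambda> v ((\<xi> # \<rho> # f)[0 := X j]) =
            (if j = Suc k then blinfun_apply \<xi> u * \<Lambda> v (a ! k # \<rho> # f) else 0)"
        proof (cases "j = Suc k")
          case True
          then show ?thesis using X_frame k by (simp add: u_def)
        next
          case False
          have "\<Lambda> v (X j # \<rho> # f) = 0"
          proof (cases "j \<le> n - 1")
            case True
            then have "X j \<in> set f"
              using X_frame[of "j - 1"] in_f[of "j - 1"] j False by auto
            then show ?thesis by (rule repeat)
          next
            case False
            then show ?thesis
              using two[of "X j # \<rho> # f" 0 1 v] X_L[of j] that j lenf order by simp
          qed
          then show ?thesis using False by simp
        qed
      qed
      finally show ?thesis using k nm lenb by simp
    qed
    define b where "b \<rho> v = \<Lambda> v (a ! k # \<rho> # f)" for \<rho> v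
    define \<epsilon> :: real where "\<epsilon> = (-1) ^ length f"
    have \<epsilon>: "\<epsilon> \<noteq> 0" by (simp add: \<epsilon>_def)
    have tail: "\<Lambda> v ((\<rho> # f) @ [\<xi>]) = - \<epsilon> * (blinfun_apply \<xi> u * b \<rho> v)" if "\<rho> \<in> L" for \<rho> v \<xi>
      using multivector_move[OF multivector, of v "[\<rho>]" f \<xi> "[]"]
        multivector_swap_adjacent[OF multivector, of v "[]" \<rho> \<xi> f] expand[OF that, of v \<xi>]
      by (simp add: b_def \<epsilon>_def)
    \<comment> \<open>The Filippov identity for \<open>F = \<rho>', f\<close> and \<open>G = a\<^sub>k, \<rho>, f\<close>; on its right-hand side only the
      slot of \<open>a\<^sub>k\<close> contributes.\<close>
    have relation: "b \<rho> u * b \<rho>' v = b \<rho>' u * b \<rho> v" if \<rho>: "\<rho> \<in> L" "\<rho>' \<in> L" for \<rho> \<rho>' v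
    proof -
      let ?G = "a ! k # \<rho> # f" and ?F = "\<rho>' # f"
      let ?R = "\<lambda>i. bracket \<Lambda> (?F @ [?G ! i])"
      have len: "length ?G = n" "Suc (length ?F) = n" using lenf by simp_all
      have zero: "\<Lambda> v (?G[i := ?R i]) = 0" if i: "i < n" "i \<noteq> 0" for i
      proof -
        have "\<Lambda> w (?F @ [?G ! i]) = 0" for w
        proof (cases "i = 1")
          case True
          then show ?thesis
            using two[of "?F @ [\<rho>]" 0 "n - 1" w] \<rho> lenf by (auto simp: nth_append)
        next
          case False
          then have "?G ! i \<in> set f"
            using i lenf by (auto simp: nth_Cons split: nat.splits)
          then show ?thesis
            by (intro multivector_not_distinct[OF multivector]) auto
        qed
        then have "?R i = 0"
          by (intro blinfun_eqI) (simp add: bracket_apply)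
        then show ?thesis
          using update_scale[OF len(1) i(1), of v 0 0] by simp
      qed
      have "\<Lambda> v (?F @ [bracket \<Lambda> ?G]) = (\<Sum>i<n. \<Lambda> v (?G[i := ?R i]))"
        by (rule filippov[OF len(2,1)])
      also have "\<dots> = (\<Sum>i\<in>{0}. \<Lambda> v (?G[i := ?R i]))"
        using zero order by (intro sum.mono_neutral_right) auto
      also have "\<dots> = blinfun_apply (?R 0) u * b \<rho> v"
        using expand[OF \<rho>(1), of v "?R 0"] by (simp add: b_def)
      also have "blinfun_apply (?R 0) u = - \<epsilon> * b \<rho>' u"
        using tail[OF \<rho>(2), of u "a ! k"] dual[of "Suc k" "Suc k"] X_frame[OF k] k nm lenb
        by (simp add: bracket_apply u_def)
      finally have "- \<epsilon> * (b \<rho> u * b \<rho>' v) = - \<epsilon> * b \<rho>' u * b \<rho> v"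
        unfolding tail[OF \<rho>(2)] by (simp add: bracket_apply b_def)
      then show ?thesis using \<epsilon> by simp
    qed
    \<comment> \<open>At \<open>p\<close> and \<open>q0\<close> the field pairs with \<open>\<gamma>\<close> and \<open>k0\<close> in a triangular way, so \<open>relation\<close>
      forces \<open>b k0 u\<close>, then \<open>b \<gamma> u\<close>, then all \<open>b \<rho> u\<close> to vanish.\<close>
    have b_abs: "\<bar>b \<rho> v\<bar> = \<bar>\<Lambda> v (a[n - 1 := \<rho>])\<bar>" for \<rho> v
      unfolding b_def by (rule multivector_permute[OF multivector msetf])
    have b_k0: "b k0 p = 0" "b k0 q0 \<noteq> 0" and b_\<gamma>: "b \<gamma> p \<noteq> 0"
      using b_abs[of k0 p] b_abs[of k0 q0] b_abs[of \<gamma> p] k0 q0 p\<gamma>[OF last] clast last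
      by (auto simp: K_def)
    have k0L: "k0 \<in> L" using k0 KL by blast
    have "b k0 u = 0"
      using relation[OF k0L \<gamma>L, of p] b_k0 b_\<gamma> by simp
    then have "b \<gamma> u = 0"
      using relation[OF k0L \<gamma>L, of q0] b_k0 by simp
    then have "b \<rho> u = 0"
      using relation[OF \<rho> \<gamma>L, of p] b_\<gamma> by simp
    then show ?thesis
      using b_abs[of \<rho> u] by (simp add: u_def)
  qed
  define b where "b i j = \<Lambda> (e i) (a[n - 1 := X j])" for i j
  define Y where "Y v = (\<Sum>i=n..CARD('m). \<Sum>j=n..CARD('m). (b i j * blinfun_apply (X i) v) *\<^sub>R e j)" for v
  have XY: "blinfun_apply (X l) (Y v) =
      (\<Sum>i=n..CARD('m). \<Sum>j=n..CARD('m). b i j * blinfun_apply (X i) v * (if l = j then 1 else 0))"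
    if "l \<in> {1..CARD('m)}" for l v
    unfolding Y_def using that order
    by (auto simp: blinfun.sum_right blinfun.scaleR_right dual intro!: sum.cong)
  let ?vs = "\<lambda>v. map e [1..<n] @ [Y v]"
  have len_vs: "length (?vs v) = n" for v using order by simp
  have wedge: "multivector n (wedge (?vs v))" for v
    using multivector_wedge[of "?vs v"] unfolding len_vs .
  have X_butlast: "map X [1..<n] = butlast a"
    by (rule nth_equalityI) (use frame Xa in auto)
  have "\<Lambda> v = wedge (?vs v)" for v
  proof (rule multivector_eqI[OF multivector wedge span])
    fix js assume js: "length js = n" "distinct js" "set js \<subseteq> {1..CARD('m)}"
    \<comment> \<open>A list of \<open>n\<close> distinct indices has one above \<open>n - 1\<close>; a second one makes both sides vanish.\<close>
    have "\<not> set js \<subseteq> {1..<n}"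
      using card_mono[of "{1..<n}" "set js"] distinct_card[OF js(2)] js(1) order by auto
    then obtain l where l: "l < n" "js ! l \<ge> n" "js ! l \<le> CARD('m)"
      using js by (auto simp: in_set_conv_nth subset_iff not_le)
    show "\<Lambda> v (map X js) = wedge (?vs v) (map X js)"
    proof (cases "\<exists>l'<n. l' \<noteq> l \<and> js ! l' \<ge> n")
      case True
      then obtain l' where l': "l' < n" "l' \<noteq> l" "js ! l' \<ge> n" by blast
      then have l'm: "js ! l' \<le> CARD('m)"
        using js by (auto simp: subset_iff)
      have "\<Lambda> v (map X js) = 0"
        using two[of "map X js" l l' v] l l' l'm js X_L by simp
      moreover have "wedge (?vs v) (map X js) = 0"
        by (rule wedge_two_rows_off_last[of l _ l']) (use l l' l'm js dual in auto)
      ultimately show ?thesis by simp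
    next
      case False
      have "set js - {js ! l} \<subseteq> {1..<n}"
        using False js by (force simp: in_set_conv_nth)
      moreover have "card (set js - {js ! l}) = card {1..<n}"
        using l js distinct_card[OF js(2)] by simp
      ultimately have "set js - {js ! l} = {1..<n}"
        by (intro card_subset_eq) auto
      then have set_js: "set js = insert (js ! l) {1..<n}"
        using l js by auto
      define j where "j = js ! l"
      have j: "n \<le> j" "j \<le> CARD('m)" using l by (simp_all add: j_def)
      have "mset ([1..<n] @ [j]) = mset js"
        by (rule mset_eq_distinct) (use js set_js j in \<open>auto simp: j_def\<close>)
      moreover have "\<Lambda> v (map X ([1..<n] @ [j])) = wedge (?vs v) (map X ([1..<n] @ [j]))"
      proof -
        have "wedge (?vs v) (map X ([1..<n] @ [j])) =
            blinfun_apply (last (map X ([1..<n] @ [j]))) (last (?vs v))"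
        proof (rule wedge_unitriangular)
          fix i i' assume "i < length (?vs v)" "i' < length (?vs v)" "Suc i < length (?vs v)"
          then have i: "Suc i < n" "i' < n" unfolding len_vs by simp_all
          then have row: "map X ([1..<n] @ [j]) ! i = X (Suc i)"
            by (simp add: nth_append less_diff_conv)
          show "blinfun_apply (map X ([1..<n] @ [j]) ! i) (?vs v ! i') = (if i = i' then 1 else 0)"
          proof (cases "Suc i' < n")
            case True
            then have "?vs v ! i' = e (Suc i')"
              by (simp add: nth_append less_diff_conv)
            then show ?thesis
              unfolding row using dual i True nm lenb by simp
          next
            case False
            then have i': "i' = n - 1" using i by simp
            then have "?vs v ! i' = Y v"
              by (simp add: nth_append)
            moreover have "blinfun_apply (X (Suc i)) (Y v) = 0"
              using XY[of "Suc i" v] i nm lenb by (auto intro!: sum.neutral)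
            ultimately show ?thesis
              unfolding row using i i' by simp
          qed
        qed (use order in auto)
        also have "\<dots> = blinfun_apply (X j) (Y v)" by simp
        also have "\<dots> = (\<Sum>i=n..CARD('m). b i j * blinfun_apply (X i) v)"
          using XY[of j v] j order by (simp add: if_distrib[of "(*) _"] cong: if_cong)
        also have "\<dots> = (\<Sum>i=1..CARD('m). b i j * blinfun_apply (X i) v)"
        proof (rule sum.mono_neutral_left)
          show "\<forall>i\<in>{1..CARD('m)} - {n..CARD('m)}. b i j * blinfun_apply (X i) v = 0"
          proof
            fix i assume "i \<in> {1..CARD('m)} - {n..CARD('m)}"
            then show "b i j * blinfun_apply (X i) v = 0"
              using invariance[of "i - 1" "X j"] X_L[OF j] by (auto simp: b_def)
          qed
        qed (use order in auto)
        also have "\<dots> = \<Lambda> v (a[n - 1 := X j])"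
          unfolding b_def by (rule at_expansion[OF coords span, symmetric])
        finally show ?thesis
          unfolding frame_last by (simp only: map_append X_butlast list.map)
      qed
      ultimately show ?thesis
        by (rule multivector_eq_permuted[OF multivector wedge])
    qed
  qed
  then have "\<Lambda> = (\<lambda>v. wedge (?vs v))"
    by (rule ext)
  then show ?thesis
    unfolding Y_def using coords by blast
qed

end

section \<open>Families supported in a common (n+1)-dimensional subspace\<close>

text \<open>For a linear 1-form the difference quotients are constant.\<close>

lemma ext_deriv_linear:
  assumes "\<And>w. linear (\<lambda>v. blinfun_apply (\<alpha> v) w)"
  shows "ext_deriv \<alpha> p u v = blinfun_apply (\<alpha> u) v - blinfun_apply (\<alpha> v) u"
proof -
  have "deriv (\<lambda>t. blinfun_apply (\<alpha> (p + t *\<^sub>R u)) w) 0 = blinfun_apply (\<alpha> u) w" for u w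
  proof -
    have "(\<lambda>t. blinfun_apply (\<alpha> (p + t *\<^sub>R u)) w) =
        (\<lambda>t. blinfun_apply (\<alpha> p) w + t * blinfun_apply (\<alpha> u) w)"
      using linear_add[OF assms] linear_cmul[OF assms] by simp
    moreover have "((\<lambda>t. blinfun_apply (\<alpha> p) w + t * blinfun_apply (\<alpha> u) w)
        has_real_derivative blinfun_apply (\<alpha> u) w) (at 0)"
      by (auto intro!: derivative_eq_intros)
    ultimately show ?thesis
      by (simp add: DERIV_imp_deriv)
  qed
  then show ?thesis
    by (simp add: ext_deriv_def)
qed

context coordinate_nambu
begin

text \<open>The Filippov identity for \<open>F = X\<^sub>k, f\<close> and \<open>G = X\<^sub>i, X\<^sub>j, f\<close>, where \<open>f\<close> lists the remaining
  coordinates of the common support, is the integrability condition \<open>\<alpha> \<and> d\<alpha> = 0\<close> on its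
  translates.\<close>

lemma curl_identity:
  assumes coords: "linear_coordinates (\<lambda>i. blinfun_apply (X i)) e"
    and span: "span (X ` {1..CARD('m)}) = UNIV" and nm: "n + 1 \<le> CARD('m)"
    and form: "\<And>v. \<Lambda> v = contract (\<Sum>l=1..n+1. blinfun_apply (\<alpha> l) v *\<^sub>R X l) (wedge (map e [1..<n+2]))"
    and ijk: "i \<in> {1..n+1}" "j \<in> {1..n+1}" "k \<in> {1..n+1}" "distinct [i, j, k]"
  shows "(blinfun_apply (\<alpha> k) (e j) - blinfun_apply (\<alpha> j) (e k)) * blinfun_apply (\<alpha> i) v +
    (blinfun_apply (\<alpha> i) (e k) - blinfun_apply (\<alpha> k) (e i)) * blinfun_apply (\<alpha> j) v +
    (blinfun_apply (\<alpha> j) (e i) - blinfun_apply (\<alpha> i) (e j)) * blinfun_apply (\<alpha> k) v = 0"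
proof -
  have dual: "blinfun_apply (X i) (e j) = (if i = j then 1 else 0)"
    if "i \<in> {1..CARD('m)}" "j \<in> {1..CARD('m)}" for i j
    using coords that by (simp add: linear_coordinates_def)
  define S where "S = wedge (map e [1..<n+2])"
  have S: "multivector (Suc n) S"
    using multivector_wedge[of "map e [1..<n+2]"] by (simp add: S_def del: upt_Suc)
  define ls where "ls = sorted_list_of_set ({1..n+1} - {i, j, k})"
  define f where "f = map X ls"
  have ls: "distinct ls" "set ls = {1..n+1} - {i, j, k}"
    by (simp_all add: ls_def)
  have "card {i, j, k} = 3"
    using ijk by simp
  then have lenf: "Suc (Suc (length f)) = n"
    using ijk order distinct_card[OF ls(1)] by (simp add: ls(2) f_def card_Diff_subset)
  have repeat: "\<Lambda> v (\<xi> # \<eta> # f) = 0" if "\<xi> = \<eta> \<or> \<xi> \<in> set f \<or> \<eta> \<in> set f" for v \<xi> \<eta>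
    by (rule multivector_not_distinct[OF multivector]) (use that in auto)
  have outside: "\<Lambda> v (X l # \<xi>s) = 0" if "l \<in> {1..CARD('m)}" "l > n + 1" for l v \<xi>s
    unfolding form contract_def
    by (rule wedge_zero_row[of 1]) (use that nm dual in auto)
  define \<sigma> where "\<sigma> = S (X i # X j # X k # f)"
  have "\<bar>\<sigma>\<bar> = 1"
  proof -
    have "set ([i, j, k] @ ls) = {1..n+1}"
      unfolding set_append ls(2) using ijk by auto
    moreover have "set [1..<n+2] = {1..n+1}"
      unfolding set_upt by auto
    moreover have "distinct ([i, j, k] @ ls)"
      using ls ijk(4) by simp
    ultimately have "mset ([i, j, k] @ ls) = mset [1..<n+2]"
      by (intro mset_eq_distinct) (simp_all only: distinct_upt)
    then have "mset (map X ([i, j, k] @ ls)) = mset (map X [1..<n+2])"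
      by (metis mset_map)
    then have "\<bar>\<sigma>\<bar> = \<bar>S (map X [1..<n+2])\<bar>"
      using multivector_permute[OF S, of "map X ([i, j, k] @ ls)" "map X [1..<n+2]"]
      by (simp add: \<sigma>_def f_def del: upt_Suc)
    also have "S (map X [1..<n+2]) = 1"
      unfolding S_def
      by (subst wedge_unitriangular) (use nm dual in \<open>auto simp: last_map simp del: upt_Suc\<close>)
    finally show ?thesis by simp
  qed
  then have \<sigma>: "\<sigma> \<noteq> 0" by auto
  \<comment> \<open>By the contraction formula, \<open>\<beta> j k\<close>, \<open>\<beta> k i\<close> and \<open>\<beta> i j\<close> are the components \<open>\<alpha>\<^sub>i\<close>, \<open>\<alpha>\<^sub>j\<close>
    and \<open>\<alpha>\<^sub>k\<close> up to the common factor \<open>\<sigma> = \<plusminus>1\<close>.\<close>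
  define \<beta> where "\<beta> s t v = \<Lambda> v (X s # X t # f)" for s t v
  have \<beta>_skew: "\<beta> t s v = - \<beta> s t v" for s t v
    using multivector_swap_adjacent[OF multivector, of v "[]" "X t" "X s" f] by (simp add: \<beta>_def)
  have \<beta>_form: "\<beta> s t v = blinfun_apply (\<alpha> u) v * S (X u # X s # X t # f)"
    if stu: "{s, t, u} = {i, j, k}" for s t u v
  proof -
    have len: "length (0 # X s # X t # f) = Suc n" "0 < Suc n"
      using lenf by simp_all
    have "\<beta> s t v = S ((0 # X s # X t # f)[0 := \<Sum>l=1..n+1. blinfun_apply (\<alpha> l) v *\<^sub>R X l])"
      by (simp add: \<beta>_def form contract_def S_def del: upt_Suc)
    also have "\<dots> = (\<Sum>l=1..n+1. blinfun_apply (\<alpha> l) v * S ((0 # X s # X t # f)[0 := X l]))"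
      by (rule multivector_update_sum[OF S len])
    also have "\<dots> = (\<Sum>l\<in>{u}. blinfun_apply (\<alpha> l) v * S ((0 # X s # X t # f)[0 := X l]))"
    proof (rule sum.mono_neutral_right)
      have "u \<in> {i, j, k}"
        unfolding stu[symmetric] by simp
      then show "{u} \<subseteq> {1..n+1}"
        using ijk by auto
      show "\<forall>l\<in>{1..n+1} - {u}. blinfun_apply (\<alpha> l) v * S ((0 # X s # X t # f)[0 := X l]) = 0"
      proof
        fix l assume "l \<in> {1..n+1} - {u}"
        then have "l \<in> {s, t} \<or> l \<in> set ls"
          unfolding ls(2) stu[symmetric] by auto
        then have "S (X l # X s # X t # f) = 0"
          by (intro multivector_not_distinct[OF S]) (auto simp: f_def)
        then show "blinfun_apply (\<alpha> l) v * S ((0 # X s # X t # f)[0 := X l]) = 0"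
          by simp
      qed
    qed simp
    finally show ?thesis by simp
  qed
  have \<beta>_values: "\<beta> j k v = blinfun_apply (\<alpha> i) v * \<sigma>" "\<beta> k i v = blinfun_apply (\<alpha> j) v * \<sigma>"
    "\<beta> i j v = blinfun_apply (\<alpha> k) v * \<sigma>" for v
  proof -
    show "\<beta> j k v = blinfun_apply (\<alpha> i) v * \<sigma>"
      by (subst \<beta>_form[of j k i]) (auto simp: \<sigma>_def)
    have "S (X j # X k # X i # f) = \<sigma>"
      using multivector_move[OF S, of "[]" "[X j, X k]" "X i" f] by (simp add: \<sigma>_def)
    then show "\<beta> k i v = blinfun_apply (\<alpha> j) v * \<sigma>"
      by (subst \<beta>_form[of k i j]) auto
    have "S (X k # X i # X j # f) = \<sigma>"
      using multivector_move[OF S, of "[]" "[X i, X j]" "X k" f] by (simp add: \<sigma>_def)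
    then show "\<beta> i j v = blinfun_apply (\<alpha> k) v * \<sigma>"
      by (subst \<beta>_form[of i j k]) auto
  qed
  have expand: "\<Lambda> v (\<xi> # X t # f) = blinfun_apply \<xi> (e i) * \<beta> i t v +
      blinfun_apply \<xi> (e j) * \<beta> j t v + blinfun_apply \<xi> (e k) * \<beta> k t v" for \<xi> t v
  proof -
    have len: "length (\<xi> # X t # f) = n" "0 < n"
      using lenf by simp_all
    have "\<Lambda> v ((\<xi> # X t # f)[0 := \<xi>]) =
        (\<Sum>l=1..CARD('m). blinfun_apply \<xi> (e l) * \<Lambda> v ((\<xi> # X t # f)[0 := X l]))"
      by (subst covector_expansion[OF coords span, of \<xi>]) (rule update_sum[OF len])
    also have "\<dots> = (\<Sum>l\<in>{i, j, k}. blinfun_apply \<xi> (e l) * \<Lambda> v ((\<xi> # X t # f)[0 := X l]))"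
    proof (rule sum.mono_neutral_right)
      show "{i, j, k} \<subseteq> {1..CARD('m)}" using ijk nm by auto
      show "\<forall>l\<in>{1..CARD('m)} - {i, j, k}. blinfun_apply \<xi> (e l) * \<Lambda> v ((\<xi> # X t # f)[0 := X l]) = 0"
      proof
        fix l assume l: "l \<in> {1..CARD('m)} - {i, j, k}"
        have "\<Lambda> v (X l # X t # f) = 0"
        proof (cases "l \<le> n + 1")
          case True
          then have "X l \<in> set f"
            using l ls(2) by (auto simp: f_def)
          then show ?thesis by (intro repeat) simp
        qed (use l outside in auto)
        then show "blinfun_apply \<xi> (e l) * \<Lambda> v ((\<xi> # X t # f)[0 := X l]) = 0" by simp
      qed
    qed simp
    finally show ?thesis
      using ijk(4) by (simp add: \<beta>_def)
  qed
  define \<epsilon> :: real where "\<epsilon> = (-1) ^ length f"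
  have \<epsilon>: "\<epsilon> \<noteq> 0" by (simp add: \<epsilon>_def)
  let ?F = "X k # f" and ?G = "X i # X j # f"
  have tail: "\<Lambda> v (?F @ [\<xi>]) = - \<epsilon> * \<Lambda> v (\<xi> # X k # f)" for v \<xi>
    using multivector_move[OF multivector, of v "[X k]" f \<xi> "[]"]
      multivector_swap_adjacent[OF multivector, of v "[]" "X k" \<xi> f]
    by (simp add: \<epsilon>_def)
  let ?R = "\<lambda>l. bracket \<Lambda> (?F @ [?G ! l])"
  have len: "length ?G = n" "Suc (length ?F) = n" using lenf by simp_all
  have in_range: "i \<in> {1..CARD('m)}" "j \<in> {1..CARD('m)}" "k \<in> {1..CARD('m)}"
    using ijk nm by auto
  have \<beta>_self: "\<beta> t t v = 0" for t v
    by (simp add: \<beta>_def repeat)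
  have R0: "blinfun_apply (?R 0) w = - \<epsilon> * \<beta> i k w" and R1: "blinfun_apply (?R 1) w = - \<epsilon> * \<beta> j k w" for w
    unfolding bracket_apply tail using ijk(4) in_range by (simp_all add: expand dual \<beta>_self)
  have zero: "\<Lambda> v (?G[l := ?R l]) = 0" if l: "l < n" "l \<notin> {0, 1}" for l
  proof -
    have "?G ! l \<in> set f"
      using l lenf by (auto simp: nth_Cons split: nat.splits)
    then have "\<Lambda> w (?F @ [?G ! l]) = 0" for w
      by (intro multivector_not_distinct[OF multivector]) auto
    then have "?R l = 0"
      by (intro blinfun_eqI) (simp add: bracket_apply)
    then show ?thesis
      using update_scale[OF len(1) l(1), of v 0 0] by simp
  qed
  have "\<Lambda> v (?F @ [bracket \<Lambda> ?G]) = (\<Sum>l<n. \<Lambda> v (?G[l := ?R l]))"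
    by (rule filippov[OF len(2,1)])
  also have "\<dots> = (\<Sum>l\<in>{0, 1}. \<Lambda> v (?G[l := ?R l]))"
    using zero order by (intro sum.mono_neutral_right) auto
  also have "\<dots> = \<Lambda> v (?R 0 # X j # f) + \<Lambda> v (X i # ?R 1 # f)"
    by simp
  also have "\<Lambda> v (X i # ?R 1 # f) = - \<Lambda> v (?R 1 # X i # f)"
    using multivector_swap_adjacent[OF multivector, of v "[]" "X i" "?R 1" f] by simp
  finally have fi: "- \<epsilon> * \<Lambda> v (bracket \<Lambda> ?G # X k # f) = \<Lambda> v (?R 0 # X j # f) - \<Lambda> v (?R 1 # X i # f)"
    unfolding tail by simp
  have G: "blinfun_apply (bracket \<Lambda> ?G) w = \<beta> i j w" for w
    by (simp add: bracket_apply \<beta>_def)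
  have "- \<epsilon> * (\<beta> i j (e i) * \<beta> i k v + \<beta> i j (e j) * \<beta> j k v) =
      - \<epsilon> * (\<beta> i k (e i) * \<beta> i j v + \<beta> i k (e k) * \<beta> k j v) +
      \<epsilon> * (\<beta> j k (e j) * \<beta> j i v + \<beta> j k (e k) * \<beta> k i v)"
    using fi unfolding expand R0 R1 G \<beta>_self by (simp add: algebra_simps)
  then have "\<epsilon> * \<sigma>\<^sup>2 * ((blinfun_apply (\<alpha> k) (e j) - blinfun_apply (\<alpha> j) (e k)) * blinfun_apply (\<alpha> i) v +
    (blinfun_apply (\<alpha> i) (e k) - blinfun_apply (\<alpha> k) (e i)) * blinfun_apply (\<alpha> j) v +
    (blinfun_apply (\<alpha> j) (e i) - blinfun_apply (\<alpha> i) (e j)) * blinfun_apply (\<alpha> k) v) = 0"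
    unfolding \<beta>_skew[of i k] \<beta>_skew[of k j] \<beta>_skew[of j i] \<beta>_values
    by (simp add: algebra_simps power2_eq_square)
  then show ?thesis
    using \<epsilon> \<sigma> by simp
qed

end

context nambu_pencil
begin

text \<open>All matrices \<open>\<Lambda> q (a[i := \<kappa>])\<close> share one row. The kernel of this row in \<open>K\<close> annihilates every
  tensor of the family and has codimension \<open>n + 1\<close>, so the supports lie in one subspace of dimension
  \<open>n + 1\<close>, and an \<open>n\<close>-vector there is the contraction of the volume element with a covector. Up to the
  factor \<open>s = \<plusminus>1\<close>, the components of this covector are the values of \<open>\<Lambda>\<close> on the frame and on
  the frame with one entry replaced by \<open>k0\<close>.\<close>

lemma contraction_form:
  assumes family: "\<forall>q. \<forall>i\<in>{..<n}. \<forall>\<kappa>\<in>K.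
      \<Lambda> q (a[i := \<kappa>]) = \<Lambda> q (a[i := k0]) * \<Lambda> q0 (a[n - 1 := \<kappa>])"
  obtains X e \<alpha> s where "linear_coordinates (\<lambda>i. blinfun_apply (X i)) e"
    "span (X ` {1..CARD('m)}) = UNIV" "n + 1 \<le> CARD('m)" "s \<noteq> 0"
    "\<And>v. blinfun_apply (\<alpha> (Suc n)) v = \<Lambda> v a / s"
    "\<And>i v. i < n \<Longrightarrow> blinfun_apply (\<alpha> (Suc i)) v = - \<Lambda> v (a[i := k0]) / s"
    "\<And>v. \<Lambda> v = contract (\<Sum>l=1..n+1. blinfun_apply (\<alpha> l) v *\<^sub>R X l) (wedge (map e [1..<n+2]))"
proof -
  have common: "\<Lambda> q (a[i := \<kappa>]) = \<Lambda> q (a[i := k0]) * \<Lambda> q0 (a[n - 1 := \<kappa>])"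
    if "i < n" "\<kappa> \<in> K" for q i \<kappa>
    by (rule family[rule_format]) (use that in simp_all)
  let ?d = "\<lambda>i \<xi>. if i < n then \<Lambda> p (a[i := \<xi>]) else \<Lambda> q0 (a[n - 1 := \<xi>])"
  have last: "n - 1 < n" using order by simp
  have len: "length (a @ [k0]) = n + 1" using frame by simp
  obtain X e where coords: "linear_coordinates (\<lambda>i. blinfun_apply (X i)) e"
    and span: "span (X ` {1..CARD('m)}) = UNIV" and nm: "length (a @ [k0]) \<le> CARD('m)"
    and Xa: "\<And>i. i < length (a @ [k0]) \<Longrightarrow> X (Suc i) = (a @ [k0]) ! i"
    and Xd: "\<And>i j. i < length (a @ [k0]) \<Longrightarrow> length (a @ [k0]) < j \<Longrightarrow> j \<le> CARD('m) \<Longrightarrow> ?d i (X j) = 0"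
  proof (rule adapted_coordinates[of "a @ [k0]" ?d])
    show "linear (?d i)" if "i < length (a @ [k0])" for i
      using frame_linear[of i p] frame_linear[OF last, of q0] by (cases "i < n") simp_all
    show "?d i ((a @ [k0]) ! j) = (if i = j then 1 else 0)"
      if "i < length (a @ [k0])" "j < length (a @ [k0])" for i j
      using update_frame[OF frame(1), of i j] update_frame[OF frame(1) last, of j q0] that frame q0 k0
      by (auto simp: nth_append K_def less_Suc_eq)
  qed blast
  have nm': "n + 1 \<le> CARD('m)" using nm len by simp
  have X_frame: "X (Suc i) = a ! i" if "i < n" for i
    using Xa[of i] that frame by (simp add: nth_append)
  have X_k0: "X (Suc n) = k0"
    using Xa[of n] frame by (simp add: nth_append)
  have dual: "blinfun_apply (X i) (e j) = (if i = j then 1 else 0)"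
    if "i \<in> {1..CARD('m)}" "j \<in> {1..CARD('m)}" for i j
    using coords that by (simp add: linear_coordinates_def)
  have outside: "\<Lambda> v (G[l := X j]) = 0"
    if j: "n + 1 < j" "j \<le> CARD('m)" and G: "length G = n" "l < n" for v G l j
  proof -
    have "\<Lambda> p (a[i := X j]) = 0" if "i < n" for i
      using Xd[of i j] that j len by simp
    then have XK: "X j \<in> K" by (simp add: K_def)
    have "\<Lambda> q0 (a[n - 1 := X j]) = 0"
      using Xd[of n j] j len by simp
    then have "\<Lambda> v (a[i := X j]) = 0" if "i < n" for i
      using common[OF that XK, of v] by simp
    then show ?thesis
      unfolding kernel_slot[OF XK G] by (intro sum.neutral) simp
  qed
  define S where "S = wedge (map e [1..<n+2])"
  have S: "multivector (Suc n) S"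
    using multivector_wedge[of "map e [1..<n+2]"] by (simp add: S_def del: upt_Suc)
  have S_outside: "S \<xi>s = 0" if "l < length \<xi>s" "\<xi>s ! l = X j" "n + 1 < j" "j \<le> CARD('m)" for \<xi>s l j
    unfolding S_def by (rule wedge_zero_row[of l]) (use that nm' dual in auto)
  have Xmap: "map X [1..<n+1] = a"
    by (rule nth_equalityI) (use frame X_frame in \<open>auto simp del: upt_Suc\<close>)
  define s where "s = S (k0 # a)"
  have s: "s \<noteq> 0"
  proof -
    have "S (map X [1..<n+2]) = 1"
      unfolding S_def
      by (subst wedge_unitriangular) (use nm' dual in \<open>auto simp: last_map simp del: upt_Suc\<close>)
    moreover have "map X [1..<n+2] = a @ [k0]"
      using Xmap X_k0 by simp
    ultimately show ?thesis
      using multivector_permute[OF S, of "k0 # a" "a @ [k0]"] by (auto simp: s_def)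
  qed
  define \<alpha> where "\<alpha> l = (if l = Suc n then (1 / s) *\<^sub>R bracket \<Lambda> a
      else (- 1 / s) *\<^sub>R bracket \<Lambda> (a[l - 1 := k0]))" for l
  have \<alpha>_last: "blinfun_apply (\<alpha> (Suc n)) v = \<Lambda> v a / s" for v
    by (simp add: \<alpha>_def blinfun.scaleR_left bracket_apply)
  have \<alpha>_frame: "blinfun_apply (\<alpha> (Suc i)) v = - \<Lambda> v (a[i := k0]) / s" if "i < n" for i v
    using that by (simp add: \<alpha>_def blinfun.minus_left blinfun.scaleR_left bracket_apply)
  have "\<Lambda> v = contract (\<Sum>l=1..n+1. blinfun_apply (\<alpha> l) v *\<^sub>R X l) S" for v
  proof -
    define \<theta> where "\<theta> = (\<Sum>l=1..n+1. blinfun_apply (\<alpha> l) v *\<^sub>R X l)"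
    have S\<theta>: "contract \<theta> S \<xi>s = (\<Sum>l=1..n+1. blinfun_apply (\<alpha> l) v * S (X l # \<xi>s))"
      if "length \<xi>s = n" for \<xi>s
    proof -
      have "length (0 # \<xi>s) = Suc n" "0 < Suc n"
        using that by simp_all
      from multivector_update_sum[OF S this, of "\<lambda>l. blinfun_apply (\<alpha> l) v" X "{1..n+1}"]
      show ?thesis
        by (simp only: contract_def \<theta>_def list_update_code)
    qed
    show "\<Lambda> v = contract \<theta> S"
    proof (rule multivector_eqI[OF multivector multivector_contract[OF S] span])
      fix js assume js: "length js = n" "distinct js" "set js \<subseteq> {1..CARD('m)}"
      show "\<Lambda> v (map X js) = contract \<theta> S (map X js)"
      proof (cases "set js \<subseteq> {1..n+1}")
        case False
        then obtain l where l: "l < n" "n + 1 < js ! l" "js ! l \<le> CARD('m)"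
          using js by (auto simp: in_set_conv_nth subset_iff not_le)
        have "(map X js)[l := X (js ! l)] = map X js"
          using l js by (simp add: list_update_same_conv)
        then have "\<Lambda> v (map X js) = 0"
          using outside[OF l(2,3), of "map X js" l v] l js by simp
        moreover have "contract \<theta> S (map X js) = 0"
          unfolding contract_def by (rule S_outside[of "Suc l" _ "js ! l"]) (use l js in auto)
        ultimately show ?thesis by simp
      next
        case True
        have "card ({1..n+1} - set js) = 1"
          using True js distinct_card[OF js(2)] by (simp add: card_Diff_subset)
        then obtain j where j: "{1..n+1} - set js = {j}"
          by (auto simp: card_1_singleton_iff)
        then have set_js: "set js = {1..n+1} - {j}" and j_in: "j \<in> {1..n+1}"
          using True by blast+
        have only_j: "contract \<theta> S (map X is) = blinfun_apply (\<alpha> j) v * S (X j # map X is)"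
          if "length is = n" "set is = {1..n+1} - {j}" for "is"
        proof -
          have "(\<Sum>l=1..n+1. blinfun_apply (\<alpha> l) v * S (X l # map X is)) =
              (\<Sum>l\<in>{j}. blinfun_apply (\<alpha> l) v * S (X l # map X is))"
          proof (rule sum.mono_neutral_right)
            show "\<forall>l\<in>{1..n+1} - {j}. blinfun_apply (\<alpha> l) v * S (X l # map X is) = 0"
            proof
              fix l assume "l \<in> {1..n+1} - {j}"
              then have "S (X l # map X is) = 0"
                using that by (intro multivector_not_distinct[OF S]) auto
              then show "blinfun_apply (\<alpha> l) v * S (X l # map X is) = 0" by simp
            qed
          qed (use j_in in auto)
          then show ?thesis
            using S\<theta>[of "map X is"] that by simp
        qed
        show ?thesis
        proof (cases "j = n + 1")
          case True
          have set_is: "set [1..<n+1] = {1..n+1} - {j}"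
            using True by (auto simp del: upt_Suc)
          have "mset [1..<n+1] = mset js"
            by (rule mset_eq_distinct) (use js set_js set_is in \<open>simp_all del: upt_Suc set_upt\<close>)
          moreover have "\<Lambda> v (map X [1..<n+1]) = contract \<theta> S (map X [1..<n+1])"
            using only_j[OF _ set_is] \<alpha>_last[of v] s True unfolding Xmap
            by (simp add: X_k0 s_def del: upt_Suc)
          ultimately show ?thesis
            by (rule multivector_eq_permuted[OF multivector multivector_contract[OF S]])
        next
          case False
          then obtain i where i: "i < n" "j = Suc i"
            using j_in by (cases j) auto
          define is' where "is' = [1..<n+1][i := n + 1]"
          have is': "length is' = n" "distinct is'" "set is' = {1..n+1} - {j}"
            using i by (auto simp: is'_def set_update_distinct distinct_list_update nth_append
                simp del: upt_Suc)
          have X_is': "map X is' = a[i := k0]"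
            using Xmap X_k0 by (simp add: is'_def map_update del: upt_Suc)
          have "mset is' = mset js"
            by (rule mset_eq_distinct) (use js set_js is' in simp_all)
          moreover have "\<Lambda> v (map X is') = contract \<theta> S (map X is')"
          proof -
            have "S (a ! i # a[i := k0]) = - s"
              using multivector_swap[OF S, of "k0 # a" 0 "Suc i" "a ! i" k0] i frame
              by (simp add: s_def)
            then show ?thesis
              using only_j[OF is'(1,3)] \<alpha>_frame[OF i(1), of v] s X_frame[OF i(1)] i(2)
              unfolding X_is' by simp
          qed
          ultimately show ?thesis
            by (rule multivector_eq_permuted[OF multivector multivector_contract[OF S]])
        qed
      qed
    qed
  qed
  then show ?thesis
    using that[OF coords span nm' s \<alpha>_last \<alpha>_frame] unfolding S_def by blast
qed

text \<open>The hypothesis \<open>rank\<close> says that the matrices do not share a column as well; then the components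
  of \<open>\<alpha>\<close> at the three points \<open>p\<close>, \<open>q0\<close>, \<open>r\<close> span a space of dimension 3. If \<open>d\<alpha>\<close>
  had a nonzero component \<open>c i j - c j i\<close>, then by \<open>curl_identity\<close> every \<open>\<alpha>\<^sub>k\<close> would be a combination of
  \<open>\<alpha>\<^sub>i\<close> and \<open>\<alpha>\<^sub>j\<close>. Hence \<open>c\<close> is symmetric in the coordinates of the support, and half of the corresponding
  quadratic form is a potential for the restriction of \<open>\<alpha>\<close>.\<close>

lemma form_B:
  assumes family: "\<forall>q. \<forall>i\<in>{..<n}. \<forall>\<kappa>\<in>K.
      \<Lambda> q (a[i := \<kappa>]) = \<Lambda> q (a[i := k0]) * \<Lambda> q0 (a[n - 1 := \<kappa>])"
    and rank: "j1 < n" "\<Lambda> r (a[j1 := k0]) \<noteq> \<Lambda> q0 (a[j1 := k0]) * \<Lambda> r (a[n - 1 := k0])"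
  shows "\<exists>(x :: nat \<Rightarrow> real ^ 'm \<Rightarrow> real) e. linear_coordinates x e \<and> n + 1 \<le> CARD('m) \<and>
    (\<exists>(\<alpha> :: real ^ 'm \<Rightarrow> ((real ^ 'm) \<Rightarrow>\<^sub>L real)) (c :: nat \<Rightarrow> nat \<Rightarrow> real) W.
        \<alpha> = (\<lambda>v. \<Sum>i=1..CARD('m). \<Sum>j=1..n+1. (c i j * x i v) *\<^sub>R differential (x j) v) \<and>
        \<Lambda> = (\<lambda>v. contract (\<alpha> v) (wedge (map e [1..<n+2]))) \<and>
        W = {v. \<forall>i \<in> {n+2..CARD('m)}. x i v = 0} \<and>
        (\<forall>p \<in> W. \<forall>u \<in> W. \<forall>v \<in> W. ext_deriv \<alpha> p u v = 0) \<and>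
        (\<exists>(\<phi> :: real ^ 'm \<Rightarrow> real) (a :: nat \<Rightarrow> nat \<Rightarrow> real).
            quadratic_polynomial_in x (n+1) \<phi> \<and>
            \<alpha> = (\<lambda>v. differential \<phi> v +
              (\<Sum>i=n+2..CARD('m). \<Sum>j=1..n+1. (a i j * x i v) *\<^sub>R differential (x j) v))))"
proof -
  obtain X e \<alpha> s where coords: "linear_coordinates (\<lambda>i. blinfun_apply (X i)) e"
    and span: "span (X ` {1..CARD('m)}) = UNIV" and nm: "n + 1 \<le> CARD('m)" and s: "s \<noteq> 0"
    and \<alpha>_last: "\<And>v. blinfun_apply (\<alpha> (Suc n)) v = \<Lambda> v a / s"
    and \<alpha>_frame: "\<And>i v. i < n \<Longrightarrow> blinfun_apply (\<alpha> (Suc i)) v = - \<Lambda> v (a[i := k0]) / s"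
    and form: "\<And>v. \<Lambda> v = contract (\<Sum>l=1..n+1. blinfun_apply (\<alpha> l) v *\<^sub>R X l) (wedge (map e [1..<n+2]))"
    by (rule contraction_form[OF family]) (rule that)
  define c where "c i j = blinfun_apply (\<alpha> j) (e i)" for i j
  have \<alpha>_c: "blinfun_apply (\<alpha> j) v = (\<Sum>i=1..CARD('m). c i j * blinfun_apply (X i) v)" for j v
    using arg_cong[OF covector_expansion[OF coords span, of "\<alpha> j"], of "\<lambda>\<xi>. blinfun_apply \<xi> v"]
    by (simp add: c_def blinfun.sum_left blinfun.scaleR_left)
  have symmetric: "c i j = c j i" if ij: "i \<in> {1..n+1}" "j \<in> {1..n+1}" for i j
  proof (rule ccontr)
    assume "c i j \<noteq> c j i"
    then have \<delta>: "c i j - c j i \<noteq> 0" and ne: "i \<noteq> j" by auto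
    have solve: "x = g / d * y + h / d * z" if "d * x = g * y + h * z" "d \<noteq> 0" for d x y z g h :: real
      using that by (simp add: field_simps)
    have dependent: "\<exists>g h. \<forall>v. blinfun_apply (\<alpha> k) v = g * blinfun_apply (\<alpha> i) v + h * blinfun_apply (\<alpha> j) v"
      if k: "k \<in> {1..n+1}" for k
    proof -
      consider "k = i" | "k = j" | "distinct [i, j, k]" using ne by auto
      then show ?thesis
      proof cases
        case 1
        then show ?thesis by (intro exI[of _ 1] exI[of _ 0]) simp
      next
        case 2
        then show ?thesis by (intro exI[of _ 0] exI[of _ 1]) simp
      next
        case 3
        have "(c i j - c j i) * blinfun_apply (\<alpha> k) v =
            (c k j - c j k) * blinfun_apply (\<alpha> i) v + (c i k - c k i) * blinfun_apply (\<alpha> j) v" for v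
          using curl_identity[OF coords span nm form ij k 3, of v] by (simp add: c_def algebra_simps)
        then have "blinfun_apply (\<alpha> k) v = (c k j - c j k) / (c i j - c j i) * blinfun_apply (\<alpha> i) v +
            (c i k - c k i) / (c i j - c j i) * blinfun_apply (\<alpha> j) v" for v
          by (intro solve \<delta>)
        then show ?thesis by blast
      qed
    qed
    have range: "Suc n \<in> {1..n+1}" "Suc (n - 1) \<in> {1..n+1}" "Suc j1 \<in> {1..n+1}"
      using order rank(1) by auto
    obtain l1 m1 where k1: "\<And>v. blinfun_apply (\<alpha> (Suc n)) v = l1 * blinfun_apply (\<alpha> i) v + m1 * blinfun_apply (\<alpha> j) v"
      using dependent[OF range(1)] by blast
    obtain l2 m2 where k2: "\<And>v. blinfun_apply (\<alpha> (Suc (n - 1))) v = l2 * blinfun_apply (\<alpha> i) v + m2 * blinfun_apply (\<alpha> j) v"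
      using dependent[OF range(2)] by blast
    obtain l3 m3 where k3: "\<And>v. blinfun_apply (\<alpha> (Suc j1)) v = l3 * blinfun_apply (\<alpha> i) v + m3 * blinfun_apply (\<alpha> j) v"
      using dependent[OF range(3)] by blast
    have last: "n - 1 < n" using order by simp
    have p: "l2 * blinfun_apply (\<alpha> i) p + m2 * blinfun_apply (\<alpha> j) p = 0"
      "l3 * blinfun_apply (\<alpha> i) p + m3 * blinfun_apply (\<alpha> j) p = 0"
      "blinfun_apply (\<alpha> i) p \<noteq> 0 \<or> blinfun_apply (\<alpha> j) p \<noteq> 0"
    proof -
      have "\<Lambda> p (a[i := k0]) = 0" if "i < n" for i
        using k0 that by (simp add: K_def)
      then show "l2 * blinfun_apply (\<alpha> i) p + m2 * blinfun_apply (\<alpha> j) p = 0"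
        "l3 * blinfun_apply (\<alpha> i) p + m3 * blinfun_apply (\<alpha> j) p = 0"
        using \<alpha>_frame[OF last, of p] \<alpha>_frame[OF rank(1), of p] last rank(1)
        unfolding k2 k3 by simp_all
      show "blinfun_apply (\<alpha> i) p \<noteq> 0 \<or> blinfun_apply (\<alpha> j) p \<noteq> 0"
        using \<alpha>_last[of p] s frame unfolding k1 by auto
    qed
    \<comment> \<open>Of the components \<open>n + 1\<close>, \<open>n\<close> and \<open>j1 + 1\<close> only the first is nonzero at \<open>p\<close>, so the
      combinations for the other two are proportional; at \<open>q0\<close> and \<open>r\<close> this contradicts \<open>rank\<close>.\<close>
    have "l2 * m3 - l3 * m2 = 0"
    proof -
      have "(l2 * m3 - l3 * m2) * blinfun_apply (\<alpha> i) p =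
          m3 * (l2 * blinfun_apply (\<alpha> i) p + m2 * blinfun_apply (\<alpha> j) p) -
          m2 * (l3 * blinfun_apply (\<alpha> i) p + m3 * blinfun_apply (\<alpha> j) p)"
        by (simp add: algebra_simps)
      moreover have "(l2 * m3 - l3 * m2) * blinfun_apply (\<alpha> j) p =
          l2 * (l3 * blinfun_apply (\<alpha> i) p + m3 * blinfun_apply (\<alpha> j) p) -
          l3 * (l2 * blinfun_apply (\<alpha> i) p + m2 * blinfun_apply (\<alpha> j) p)"
        by (simp add: algebra_simps)
      ultimately show ?thesis
        unfolding p(1,2) using p(3) by auto
    qed
    moreover have "blinfun_apply (\<alpha> (Suc (n - 1))) q0 * blinfun_apply (\<alpha> (Suc j1)) r -
        blinfun_apply (\<alpha> (Suc (n - 1))) r * blinfun_apply (\<alpha> (Suc j1)) q0 =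
        (l2 * m3 - l3 * m2) * (blinfun_apply (\<alpha> i) q0 * blinfun_apply (\<alpha> j) r -
          blinfun_apply (\<alpha> i) r * blinfun_apply (\<alpha> j) q0)"
      unfolding k2 k3 by (simp add: algebra_simps)
    ultimately have "(\<Lambda> q0 (a[n - 1 := k0]) / s) * (\<Lambda> r (a[j1 := k0]) / s) =
        (\<Lambda> r (a[n - 1 := k0]) / s) * (\<Lambda> q0 (a[j1 := k0]) / s)"
      unfolding \<alpha>_frame[OF last] \<alpha>_frame[OF rank(1)] by simp
    then show False
      using s rank(2) q0 by (simp add: field_simps)
  qed
  define \<theta> where "\<theta> v = (\<Sum>l=1..n+1. blinfun_apply (\<alpha> l) v *\<^sub>R X l)" for v
  have \<theta>_c: "\<theta> v = (\<Sum>i=1..CARD('m). \<Sum>j=1..n+1. (c i j * blinfun_apply (X i) v) *\<^sub>R X j)" for v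
    unfolding \<theta>_def \<alpha>_c scaleR_sum_left by (rule sum.swap)
  define W where "W = {v. \<forall>i\<in>{n+2..CARD('m)}. blinfun_apply (X i) v = 0}"
  have split: "{1..CARD('m)} = {1..n+1} \<union> {n+2..CARD('m)}" "{1..n+1} \<inter> {n+2..CARD('m)} = {}"
    using nm by auto
  have closed: "ext_deriv \<theta> q u v = 0" if "u \<in> W" "v \<in> W" for q u v
  proof -
    have lin: "linear (\<lambda>v. blinfun_apply (\<theta> v) w)" for w
    proof -
      have "blinfun_apply (\<theta> v) w = (\<Sum>l=1..n+1. blinfun_apply (\<alpha> l) v * blinfun_apply (X l) w)" for v
        by (simp only: \<theta>_def blinfun.sum_left blinfun.scaleR_left real_scaleR_def)
      then show ?thesis
        by (intro linearI)
          (simp_all only: blinfun.add_right blinfun.scaleR_right real_scaleR_def distrib_right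
            sum.distrib sum_distrib_left mult.assoc)
    qed
    have pairing: "blinfun_apply (\<theta> u) v =
        (\<Sum>i=1..n+1. \<Sum>j=1..n+1. c i j * blinfun_apply (X i) u * blinfun_apply (X j) v)" if "u \<in> W" for u v
      unfolding \<theta>_c split(1) using that
      by (subst sum.union_disjoint[OF _ _ split(2)])
        (auto simp: W_def blinfun.sum_left blinfun.scaleR_left simp del: sum.cl_ivl_Suc)
    have "blinfun_apply (\<theta> v) u =
        (\<Sum>j=1..n+1. \<Sum>i=1..n+1. c i j * blinfun_apply (X i) v * blinfun_apply (X j) u)"
      unfolding pairing[OF that(2)] by (rule sum.swap)
    also have "\<dots> = blinfun_apply (\<theta> u) v"
      unfolding pairing[OF that(1)] by (intro sum.cong refl) (simp add: symmetric)
    finally show ?thesis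
      by (simp add: ext_deriv_linear[OF lin])
  qed
  define \<phi> where "\<phi> v = (\<Sum>i=1..n+1. \<Sum>j=1..n+1. (c i j / 2) * blinfun_apply (X i) v * blinfun_apply (X j) v)" for v
  have quad: "quadratic_polynomial_in (\<lambda>i. blinfun_apply (X i)) (n + 1) \<phi>"
    unfolding quadratic_polynomial_in_def
    by (intro exI[of _ 0] exI[of _ "\<lambda>_. 0"] exI[of _ "\<lambda>i j. c i j / 2"]) (simp add: \<phi>_def[abs_def] del: sum.cl_ivl_Suc)
  have d\<phi>: "differential \<phi> v = (\<Sum>i=1..n+1. \<Sum>j=1..n+1. (c i j * blinfun_apply (X i) v) *\<^sub>R X j)" for v
  proof -
    let ?J = "{1..n+1} \<times> {1..n+1}"
    let ?h = "\<lambda>i j. (c i j / 2 * blinfun_apply (X i) v) *\<^sub>R X j"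
    have "\<phi> = (\<lambda>v. \<Sum>ij\<in>?J. c (fst ij) (snd ij) / 2 * blinfun_apply (X (fst ij)) v * blinfun_apply (X (snd ij)) v)"
      by (simp add: \<phi>_def[abs_def] sum.cartesian_product case_prod_beta del: sum.cl_ivl_Suc)
    then have "differential \<phi> v = (\<Sum>ij\<in>?J. ?h (fst ij) (snd ij) +
        (c (fst ij) (snd ij) / 2 * blinfun_apply (X (snd ij)) v) *\<^sub>R X (fst ij))"
      using differential_quadratic[of ?J "\<lambda>ij. c (fst ij) (snd ij) / 2" "\<lambda>ij. X (fst ij)" "\<lambda>ij. X (snd ij)" v]
      by simp
    also have "\<dots> = (\<Sum>i=1..n+1. \<Sum>j=1..n+1. ?h i j) +
        (\<Sum>i=1..n+1. \<Sum>j=1..n+1. (c i j / 2 * blinfun_apply (X j) v) *\<^sub>R X i)"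
      by (simp add: sum.distrib sum.cartesian_product case_prod_beta del: sum.cl_ivl_Suc)
    also have "(\<Sum>i=1..n+1. \<Sum>j=1..n+1. (c i j / 2 * blinfun_apply (X j) v) *\<^sub>R X i) =
        (\<Sum>j=1..n+1. \<Sum>i=1..n+1. (c i j / 2 * blinfun_apply (X j) v) *\<^sub>R X i)"
      by (rule sum.swap)
    also have "\<dots> = (\<Sum>i=1..n+1. \<Sum>j=1..n+1. ?h i j)"
      by (intro sum.cong refl) (simp add: symmetric)
    finally show ?thesis
      by (simp add: scaleR_add_left[symmetric] del: sum.cl_ivl_Suc flip: sum.distrib)
  qed
  have potential: "\<theta> v = differential \<phi> v + (\<Sum>i=n+2..CARD('m). \<Sum>j=1..n+1. (c i j * blinfun_apply (X i) v) *\<^sub>R X j)" for v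
    unfolding \<theta>_c d\<phi> split(1) by (rule sum.union_disjoint[OF _ _ split(2)]) auto
  let ?x = "\<lambda>i. blinfun_apply (X i)"
  show ?thesis
  proof (intro exI conjI)
    show "linear_coordinates ?x e" by (rule coords)
    show "n + 1 \<le> CARD('m)" by (rule nm)
    show "\<theta> = (\<lambda>v. \<Sum>i=1..CARD('m). \<Sum>j=1..n+1. (c i j * ?x i v) *\<^sub>R differential (?x j) v)"
      unfolding differential_covector by (rule ext) (rule \<theta>_c)
    show "\<Lambda> = (\<lambda>v. contract (\<theta> v) (wedge (map e [1..<n+2])))"
      unfolding \<theta>_def by (rule ext) (rule form)
    show "W = {v. \<forall>i\<in>{n+2..CARD('m)}. ?x i v = 0}" by (rule W_def)
    show "\<forall>p\<in>W. \<forall>u\<in>W. \<forall>v\<in>W. ext_deriv \<theta> p u v = 0"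
      using closed by blast
    show "quadratic_polynomial_in ?x (n + 1) \<phi>" by (rule quad)
    show "\<theta> = (\<lambda>v. differential \<phi> v +
        (\<Sum>i=n+2..CARD('m). \<Sum>j=1..n+1. (c i j * ?x i v) *\<^sub>R differential (?x j) v))"
      unfolding differential_covector by (rule ext) (rule potential)
  qed
qed

end

section \<open>The classification\<close>

lemma (in coordinate_nambu) pencil_at_last_slot:
  assumes \<kappa>: "\<kappa> \<in> K" and q: "\<Lambda> q (a[n - 1 := \<kappa>]) \<noteq> 0"
  shows "\<exists>q0. nambu_pencil n \<Lambda> p a q0 \<kappa>"
proof
  let ?q = "q - \<Lambda> q a *\<^sub>R p"
  have z: "\<Lambda> p (a[n - 1 := \<kappa>]) = 0"
    using \<kappa> order by (simp add: K_def)
  show "nambu_pencil n \<Lambda> p a ((1 / \<Lambda> q (a[n - 1 := \<kappa>])) *\<^sub>R ?q) \<kappa>"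
  proof unfold_locales
    show "\<Lambda> ((1 / \<Lambda> q (a[n - 1 := \<kappa>])) *\<^sub>R ?q) a = 0"
      by (simp add: at_scale at_diff frame)
    show "\<Lambda> ((1 / \<Lambda> q (a[n - 1 := \<kappa>])) *\<^sub>R ?q) (a[n - 1 := \<kappa>]) = 1"
      unfolding at_scale at_diff z using q by simp
    show "\<kappa> \<in> K" by (rule \<kappa>)
  qed
qed

text \<open>Exchanging slot \<open>i\<close> with the last one changes the sign of \<open>\<Lambda> p\<close>, which is repaired by passing to
  \<open>- p\<close>.\<close>

lemma (in coordinate_nambu) pencil_exists:
  assumes i: "i < n" and \<kappa>: "\<kappa> \<in> K" and q: "\<Lambda> q (a[i := \<kappa>]) \<noteq> 0"
  shows "\<exists>p' a' q0. nambu_pencil n \<Lambda> p' a' q0 \<kappa>"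
proof (cases "i = n - 1")
  case True
  then show ?thesis
    using pencil_at_last_slot[OF \<kappa>, of q] q by blast
next
  case False
  define a' where "a' = a[i := a ! (n - 1), n - 1 := a ! i]"
  have last: "n - 1 < n" using order by simp
  have a': "length a' = n" using frame by (simp add: a'_def)
  have same: "a[i := a ! i, n - 1 := a ! (n - 1)] = a"
    by simp
  have neg: "\<Lambda> (- p) \<xi>s = - \<Lambda> p \<xi>s" for \<xi>s
    using at_scale[of "-1" p \<xi>s] by simp
  have "\<Lambda> p a' = - \<Lambda> p a"
    using multivector_swap[OF multivector frame(1) i last False, of p "a ! (n - 1)" "a ! i"]
    unfolding a'_def same .
  then have one: "\<Lambda> (- p) a' = 1"
    using frame by (simp add: neg)
  interpret swapped: coordinate_nambu n \<Lambda> "- p" a'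
    by unfold_locales (rule a' one)+
  have \<kappa>': "\<kappa> \<in> swapped.K"
    unfolding swapped.K_def using K_kernel[OF \<kappa> a'] by (simp add: neg)
  have "\<Lambda> q (a'[n - 1 := \<kappa>]) = - \<Lambda> q (a[i := \<kappa>, n - 1 := a ! (n - 1)])"
    using multivector_swap[OF multivector frame(1) i last False, of q "a ! (n - 1)" \<kappa>]
    by (simp add: a'_def)
  also have "a[i := \<kappa>, n - 1 := a ! (n - 1)] = a[i := \<kappa>]"
    using False list_update_id[of "a[i := \<kappa>]" "n - 1"] by simp
  finally show ?thesis
    using swapped.pencil_at_last_slot[OF \<kappa>', of q] q by auto
qed

theorem corollary2:
  fixes \<Lambda> :: "real ^ 'm \<Rightarrow> ((real ^ 'm) \<Rightarrow>\<^sub>L real) list \<Rightarrow> real"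
    and n m :: nat
  assumes "n > 2"
    and "m = CARD('m)"
    and "nambu_poisson n \<Lambda>"
    and "linear_multivector_field n \<Lambda>"
  shows "\<exists>(x :: nat \<Rightarrow> real ^ 'm \<Rightarrow> real) (e :: nat \<Rightarrow> real ^ 'm).
    linear_coordinates x e \<and>
    (\<comment> \<open>(A)\<close>
     (\<exists>\<phi> :: real ^ 'm \<Rightarrow> real. linear \<phi> \<and> \<Lambda> = (\<lambda>v \<xi>s. \<phi> v * wedge (map e [1..<n+1]) \<xi>s))
     \<or>
     \<comment> \<open>(C)\<close>
     (\<exists>a :: nat \<Rightarrow> nat \<Rightarrow> real.
        \<Lambda> = (\<lambda>v. wedge (map e [1..<n] @ [\<Sum>i=n..m. \<Sum>j=n..m. (a i j * x i v) *\<^sub>R e j])))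
     \<or>
     \<comment> \<open>(B)\<close>
     (n + 1 \<le> m \<and>
      (\<exists>(\<alpha> :: real ^ 'm \<Rightarrow> ((real ^ 'm) \<Rightarrow>\<^sub>L real)) (c :: nat \<Rightarrow> nat \<Rightarrow> real) W.
        \<alpha> = (\<lambda>v. \<Sum>i=1..m. \<Sum>j=1..n+1. (c i j * x i v) *\<^sub>R differential (x j) v) \<and>
        \<Lambda> = (\<lambda>v. contract (\<alpha> v) (wedge (map e [1..<n+2]))) \<and>
        W = {v. \<forall>i \<in> {n+2..m}. x i v = 0} \<and>
        (\<comment> \<open>(1)\<close>
         (\<forall>p \<in> W. \<forall>u \<in> W. \<forall>v \<in> W. ext_deriv \<alpha> p u v = 0) \<and>
         (\<exists>(\<phi> :: real ^ 'm \<Rightarrow> real) (a :: nat \<Rightarrow> nat \<Rightarrow> real).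
            quadratic_polynomial_in x (n+1) \<phi> \<and>
            \<alpha> = (\<lambda>v. differential \<phi> v +
                   (\<Sum>i=n+2..m. \<Sum>j=1..n+1. (a i j * x i v) *\<^sub>R differential (x j) v)))
         \<or>
         \<comment> \<open>(2)\<close>
         (\<exists>u \<in> W. \<exists>v \<in> W. ext_deriv \<alpha> 0 u v \<noteq> 0) \<and>
         (\<exists>(\<phi> :: real ^ 'm \<Rightarrow> real) (a :: nat \<Rightarrow> real) (b :: nat \<Rightarrow> real).
            quadratic_polynomial_in x 2 \<phi> \<and>
            \<alpha> = (\<lambda>v. differential \<phi> v + (1/2) *\<^sub>R
                   ((x 1 v + (\<Sum>i=3..m. a i * x i v)) *\<^sub>R differential (x 2) v
                    - (x 2 v + (\<Sum>j=3..m. b j * x j v)) *\<^sub>R differential (x 1) v)))))))"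
proof -
  interpret linear_nambu n \<Lambda>
    using assms by (intro linear_nambu.intro linear_multivector.intro linear_nambu_axioms.intro)
      (simp_all add: linear_multivector_field_def multivector_field_def)
  have A: ?thesis if "\<exists>(x :: nat \<Rightarrow> real ^ 'm \<Rightarrow> real) e \<phi>. linear_coordinates x e \<and> linear \<phi> \<and>
      \<Lambda> = (\<lambda>v \<xi>s. \<phi> v * wedge (map e [1..<n+1]) \<xi>s)"
    using that by (elim exE conjE)
      (rule exI, rule exI, rule conjI, assumption, rule disjI1, rule exI, rule conjI, assumption+)
  have C: ?thesis if "\<exists>(x :: nat \<Rightarrow> real ^ 'm \<Rightarrow> real) e b. linear_coordinates x e \<and>
      \<Lambda> = (\<lambda>v. wedge (map e [1..<n] @ [\<Sum>i=n..CARD('m). \<Sum>j=n..CARD('m). (b i j * x i v) *\<^sub>R e j]))"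
    using that unfolding assms(2) by (elim exE conjE)
      (rule exI, rule exI, rule conjI, assumption, rule disjI2, rule disjI1, rule exI, assumption)
  show ?thesis
  proof (cases "\<exists>p a. \<Lambda> p a \<noteq> 0")
    case False
    obtain X :: "nat \<Rightarrow> ((real ^ 'm) \<Rightarrow>\<^sub>L real)" and e where
      "linear_coordinates (\<lambda>i. blinfun_apply (X i)) e"
      by (rule adapted_coordinates[of "[]"]) auto
    moreover have "\<Lambda> = (\<lambda>v \<xi>s. 0 * wedge (map e [1..<n+1]) \<xi>s)"
      using False by (simp add: fun_eq_iff)
    moreover have "linear (\<lambda>v :: real ^ 'm. 0 :: real)"
      by (rule linear_zero)
    ultimately show ?thesis
      by (intro A exI conjI)
  next
    case True
    then obtain p a where pa: "\<Lambda> p a \<noteq> 0" by blast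
    then have "length a = n"
      using multivector_length[OF multivector] by blast
    moreover have "\<Lambda> ((1 / \<Lambda> p a) *\<^sub>R p) a = 1"
      using pa by (simp add: at_scale)
    ultimately interpret coordinate_nambu n \<Lambda> "(1 / \<Lambda> p a) *\<^sub>R p" a
      by unfold_locales
    show ?thesis
    proof (cases "\<exists>q i. \<exists>\<kappa>\<in>K. i < n \<and> \<Lambda> q (a[i := \<kappa>]) \<noteq> 0")
      case False
      then have "\<Lambda> q (a[i := \<kappa>]) = 0" if "i < n" "\<kappa> \<in> K" for q i \<kappa>
        using that by blast
      from form_A[OF this] show ?thesis by (rule A)
    next
      case True
      then obtain p' a' q0 k0 where "nambu_pencil n \<Lambda> p' a' q0 k0"
        using pencil_exists by blast
      then interpret pencil: nambu_pencil n \<Lambda> p' a' q0 k0 .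
      have dichotomy: "(\<forall>q. \<forall>i\<in>{..<n}. \<forall>\<kappa>\<in>pencil.K. \<Lambda> q (a'[i := \<kappa>]) = \<Lambda> q (a'[i := k0]) * \<Lambda> q0 (a'[n - 1 := \<kappa>])) \<or>
          (\<forall>q. \<forall>i\<in>{..<n}. \<forall>\<kappa>\<in>pencil.K. \<Lambda> q (a'[i := \<kappa>]) = \<Lambda> q0 (a'[i := k0]) * \<Lambda> q (a'[n - 1 := \<kappa>]))"
        by (rule rank_one_family_dichotomy)
          (use linear order pencil.k0 pencil.q0 pencil.kernel_rank_one in auto)
      show ?thesis
      proof (cases "\<forall>q. \<forall>i\<in>{..<n}. \<forall>\<kappa>\<in>pencil.K. \<Lambda> q (a'[i := \<kappa>]) = \<Lambda> q0 (a'[i := k0]) * \<Lambda> q (a'[n - 1 := \<kappa>])")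
        case True
        from pencil.form_C[OF this] show ?thesis by (rule C)
      next
        case False
        have family: "\<forall>q. \<forall>i\<in>{..<n}. \<forall>\<kappa>\<in>pencil.K. \<Lambda> q (a'[i := \<kappa>]) = \<Lambda> q (a'[i := k0]) * \<Lambda> q0 (a'[n - 1 := \<kappa>])"
          by (rule disjE[OF dichotomy], assumption, rule notE[OF False], assumption)
        obtain r j \<kappa> where j: "j < n" and \<kappa>: "\<kappa> \<in> pencil.K"
          and ne: "\<Lambda> r (a'[j := \<kappa>]) \<noteq> \<Lambda> q0 (a'[j := k0]) * \<Lambda> r (a'[n - 1 := \<kappa>])"
          using False by blast
        have last: "n - 1 < n" using order by simp
        have "\<Lambda> r (a'[j := k0]) \<noteq> \<Lambda> q0 (a'[j := k0]) * \<Lambda> r (a'[n - 1 := k0])"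
          using ne family[rule_format, of j \<kappa> r]
            family[rule_format, of "n - 1" \<kappa> r] j last \<kappa> by auto
        from pencil.form_B[OF family j this] obtain x e \<alpha> c W \<phi> b where
          coords: "linear_coordinates x e" and nm: "n + 1 \<le> CARD('m)"
          and \<alpha>: "\<alpha> = (\<lambda>v. \<Sum>i=1..CARD('m). \<Sum>j=1..n+1. (c i j * x i v) *\<^sub>R differential (x j) v)"
          and \<Lambda>: "\<Lambda> = (\<lambda>v. contract (\<alpha> v) (wedge (map e [1..<n+2])))"
          and W: "W = {v. \<forall>i \<in> {n+2..CARD('m)}. x i v = 0}"
          and closed: "\<forall>p \<in> W. \<forall>u \<in> W. \<forall>v \<in> W. ext_deriv \<alpha> p u v = 0"
          and \<phi>: "quadratic_polynomial_in x (n+1) \<phi>"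
          and potential: "\<alpha> = (\<lambda>v. differential \<phi> v +
            (\<Sum>i=n+2..CARD('m). \<Sum>j=1..n+1. (b i j * x i v) *\<^sub>R differential (x j) v))"
          by (elim exE conjE) (rule that)
        show ?thesis
          unfolding assms(2)
        proof (rule exI[of _ x], rule exI[of _ e], rule conjI[OF coords], rule disjI2, rule disjI2,
            rule conjI[OF nm], rule exI[of _ \<alpha>], rule exI[of _ c], rule exI[of _ W],
            intro conjI disjI1 exI)
          show "quadratic_polynomial_in x (n+1) \<phi>" by (rule \<phi>)
        qed (rule \<alpha> \<Lambda> W closed potential)+
      qed
    qed
  qed
qed

end
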